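(* For every fixed integer $n\ge 3$ there exist constants $c_n,C_n>0$ (depending only on $n$) such that the following holds for every integer $R\ge 1$. Let $g:\Delta_{nR}^{(n)}\to\mathbb R$ satisfy $g(R\mathbf 1_n)\neq 0$ and $$\left|\sum_{i=1}^n g(\beta+e_i)\right|\le \mathrm e^{-C_nR}\,|g(R\mathbf 1_n)|\qquad\text{for all }\beta\in\Delta_{nR-1}^{(n)}.$$ Then $$\#\left\{\alpha\in\Delta_{nR}^{(n)}:\ |g(\alpha)|\ge \mathrm e^{-C_nR}\,|g(R\mathbf 1_n)|\right\}\ \ge\ c_nR^{\lceil n/2\rceil}.$$
   Context: For integers $N\ge 0$ and $n\ge 1$, $\Delta_N^{(n)}:=\{\alpha=(\alpha_1,\dots,\alpha_n)\in\mathbb Z_{\ge 0}^n:\ \sum_{i=1}^n\alpha_i=N\}$ is the simplex lattice. $e_i$ denotes the $i$th coordinate vector in $\mathbb Z^n$, $\mathbf 1_n=(1,\dots,1)\in\mathbb Z^n$, $\mathrm e$ is Euler's number, $\lceil\cdot\rceil$ is the usual ceiling function, and $\#$ denotes cardinality. *)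

theory Defs
  imports Complex_Main "HOL-Library.Function_Algebras"
begin

text \<open>
  A vector \<open>\<alpha> = (\<alpha>\<^sub>1, \<dots>, \<alpha>\<^sub>n)\<close> of natural numbers is encoded as a function
  \<open>nat \<Rightarrow> nat\<close> that vanishes outside the index set \<open>{1..n}\<close>. The encoding is unique, so
  cardinalities agree, and vector addition is pointwise addition of functions.
\<close>

definition simplex_lattice :: "nat \<Rightarrow> nat \<Rightarrow> (nat \<Rightarrow> nat) set" where
  "simplex_lattice n N = {\<alpha>. (\<forall>i. i \<notin> {1..n} \<longrightarrow> \<alpha> i = 0) \<and> (\<Sum>i=1..n. \<alpha> i) = N}"

definition unit_vec :: "nat \<Rightarrow> nat \<Rightarrow> nat" where
  "unit_vec i = (\<lambda>j. if j = i then 1 else 0)"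

text \<open>\<open>diag_vec n R\<close> is \<open>R\<close> times the all-ones vector of length \<open>n\<close>.\<close>

definition diag_vec :: "nat \<Rightarrow> nat \<Rightarrow> nat \<Rightarrow> nat" where
  "diag_vec n R = (\<lambda>j. if j \<in> {1..n} then R else 0)"

end

theory Submission
  imports Defs "HOL-Computational_Algebra.Polynomial" "HOL-Library.FuncSet" "HOL-Library.Disjoint_Sets"
begin

text \<open>
  Let \<open>k = \<lceil>n / 2\<rceil>\<close>. For every \<open>t \<in> {0..R}\<^sup>n\<close> let \<open>q\<close> maximise \<open>\<bar>g \<alpha>\<bar> exp (- \<Sum> \<lambda>\<^sub>i \<alpha>\<^sub>i)\<close> over the lattice
  points \<open>\<alpha> \<ge> t\<close>, where \<open>\<lambda>\<^sub>1, \<lambda>\<^sub>2, \<dots>\<close> decrease rapidly, and let \<open>e\<close> be the \<open>k\<close>-th largest of the gaps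
  \<open>q\<^sub>i - t\<^sub>i\<close>. Choose a set \<open>J\<close> of \<open>k\<close> coordinates with gap at least \<open>e\<close>.

  For \<open>c \<in> {0..e}\<^sup>J\<close> apply the sum of the shifts in the directions of \<open>J\<close>, \<open>\<Sum> c\<close> times, to \<open>g\<close> at \<open>q - c\<close>. By
  maximality of \<open>q\<close> the values of \<open>g\<close> drop off exponentially below \<open>q\<close>, which makes the result, one coordinate at a
  time, a polynomial of small degree with a large coefficient; hence it is large for a positive proportion of the
  \<open>c\<close>. By hypothesis the sum of the shifts in \<open>J\<close> is nearly minus the sum of the shifts in the other directions,
  so each such \<open>c\<close> yields a point with large \<open>\<bar>g\<bar>\<close> whose \<open>J\<close>-coordinates are exactly those of \<open>q - c\<close>. Thus a
  ball of radius proportional to \<open>e\<close> around \<open>q\<close> contains at least \<open>const * (e + 1)\<^sup>k\<close> such points.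

  As \<open>n + 1 \<ge> 2 k\<close>, at least \<open>k\<close> gaps are also at most \<open>e\<close>, so the \<open>t\<close> whose ball is no larger than a given
  ball and meets it number at most \<open>const * (e + 1)\<^sup>k (R + 1)\<^sup>n\<^sup>-\<^sup>k\<close>. A Vitali selection of disjoint balls
  therefore has \<open>\<Sum> (e + 1)\<^sup>k \<ge> const * R\<^sup>k\<close>.
\<close>

section \<open>Powers of sums of unit shifts\<close>

definition shift_sum :: "nat set \<Rightarrow> ((nat \<Rightarrow> nat) \<Rightarrow> real) \<Rightarrow> (nat \<Rightarrow> nat) \<Rightarrow> real" where
  "shift_sum A u \<gamma> = (\<Sum>i\<in>A. u (\<gamma> + unit_vec i))"

text \<open>These are the displacements that occur when \<open>shift_sum A ^^ m\<close> is expanded: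
  the exponent vectors of the monomials of degree \<open>m\<close> in variables indexed by
  \<open>A\<close>.\<close>

definition compositions :: "nat set \<Rightarrow> nat \<Rightarrow> (nat \<Rightarrow> nat) set" where
  "compositions A m = {\<delta>. (\<forall>i. i \<notin> A \<longrightarrow> \<delta> i = 0) \<and> sum \<delta> A = m}"

lemma shift_sum_commute: "shift_sum A (shift_sum B u) = shift_sum B (shift_sum A u)"
  unfolding shift_sum_def fun_eq_iff
  by (intro allI, subst sum.swap) (simp add: add_ac)

lemma shift_sum_pow_commute:
  "(shift_sum A ^^ m) (shift_sum B u) = shift_sum B ((shift_sum A ^^ m) u)"
  by (induction m) (simp_all add: shift_sum_commute[of A B])

lemma add_unit_vec_composition:
  assumes "finite A" "\<delta> \<in> compositions A m" "i \<in> A"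
  shows "unit_vec i + \<delta> \<in> compositions A (Suc m)"
proof -
  have "sum (unit_vec i) A = 1"
    using assms by (simp add: unit_vec_def)
  then show ?thesis
    using assms by (auto simp: compositions_def plus_fun_def sum.distrib unit_vec_def)
qed

text \<open>Full expansion gives \<open>card A ^ m\<close> terms, each a value of \<open>u\<close>
  at a displacement in \<open>compositions A m\<close>.\<close>

lemma shift_sum_pow_bound:
  assumes "finite A" "\<And>\<delta>. \<delta> \<in> compositions A m \<Longrightarrow> \<bar>u (\<gamma> + \<delta>)\<bar> \<le> M"
  shows "\<bar>(shift_sum A ^^ m) u \<gamma>\<bar> \<le> real (card A) ^ m * M"
  using assms(2)
proof (induction m arbitrary: \<gamma>)
  case 0
  have "(0 :: nat \<Rightarrow> nat) \<in> compositions A 0"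
    by (simp add: compositions_def zero_fun_def)
  from 0[OF this] show ?case by simp
next
  case (Suc m)
  have "\<bar>(shift_sum A ^^ m) u (\<gamma> + unit_vec i)\<bar> \<le> real (card A) ^ m * M" if "i \<in> A" for i
  proof (rule Suc.IH)
    fix \<delta> assume "\<delta> \<in> compositions A m"
    from Suc.prems[OF add_unit_vec_composition[OF assms(1) this that]]
    show "\<bar>u (\<gamma> + unit_vec i + \<delta>)\<bar> \<le> M"
      unfolding add.assoc .
  qed
  then have "(\<Sum>i\<in>A. \<bar>(shift_sum A ^^ m) u (\<gamma> + unit_vec i)\<bar>) \<le> real (card A) * (real (card A) ^ m * M)"
    using sum_bounded_above[of A "\<lambda>i. \<bar>(shift_sum A ^^ m) u (\<gamma> + unit_vec i)\<bar>"] by simp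
  then have "\<bar>\<Sum>i\<in>A. (shift_sum A ^^ m) u (\<gamma> + unit_vec i)\<bar> \<le> real (card A) * (real (card A) ^ m * M)"
    by (rule order_trans[OF sum_abs])
  then show ?case
    by (simp add: shift_sum_def[of A "(shift_sum A ^^ m) u"] mult.assoc)
qed

text \<open>This is the binomial theorem for two commuting operators, the single shift in direction
  \<open>b\<close> and \<open>shift_sum A\<close>.\<close>

lemma shift_sum_pow_insert:
  assumes "finite A" "b \<notin> A"
  shows "(shift_sum (insert b A) ^^ j) u \<gamma> =
    (\<Sum>m\<le>j. real (j choose m) * (shift_sum A ^^ m) u (\<gamma>(b := \<gamma> b + (j - m))))"
proof (induction j arbitrary: \<gamma>)
  case 0
  then show ?case by simp
next
  case (Suc j)
  define T where "T m s = (shift_sum A ^^ m) u (\<gamma>(b := \<gamma> b + s))" for m s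
  \<comment> \<open>The outermost application is split: direction \<open>b\<close> adds one more
    \<open>b\<close>-shift, while the directions in \<open>A\<close> raise \<open>m\<close>.
    Pascal's rule then merges the two sums.\<close>
  have b: "(shift_sum (insert b A) ^^ j) u (\<gamma> + unit_vec b) =
      (\<Sum>m\<le>j. real (j choose m) * T m (Suc j - m))"
    unfolding Suc.IH T_def
  proof (intro sum.cong refl arg_cong2[where f = "(*)"] arg_cong[where f = "(shift_sum A ^^ _) u"])
    fix m assume "m \<in> {..j}"
    then show "(\<gamma> + unit_vec b)(b := (\<gamma> + unit_vec b) b + (j - m)) = \<gamma>(b := \<gamma> b + (Suc j - m))"
      by (auto simp: fun_eq_iff unit_vec_def)
  qed
  have A: "(\<Sum>i\<in>A. (shift_sum (insert b A) ^^ j) u (\<gamma> + unit_vec i)) =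
      (\<Sum>m\<le>j. real (j choose m) * T (Suc m) (j - m))"
  proof -
    have "(\<Sum>i\<in>A. (shift_sum (insert b A) ^^ j) u (\<gamma> + unit_vec i)) =
      (\<Sum>i\<in>A. \<Sum>m\<le>j. real (j choose m) * (shift_sum A ^^ m) u (\<gamma>(b := \<gamma> b + (j - m)) + unit_vec i))"
      unfolding Suc.IH
    proof (intro sum.cong refl arg_cong2[where f = "(*)"] arg_cong[where f = "(shift_sum A ^^ _) u"])
      fix m i assume "i \<in> A"
      then show "(\<gamma> + unit_vec i)(b := (\<gamma> + unit_vec i) b + (j - m)) = \<gamma>(b := \<gamma> b + (j - m)) + unit_vec i"
        using assms by (auto simp: fun_eq_iff unit_vec_def)
    qed
    also have "\<dots> = (\<Sum>m\<le>j. real (j choose m) * T (Suc m) (j - m))"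
      by (subst sum.swap) (simp add: T_def shift_sum_def[of A "(shift_sum A ^^ _) u"] sum_distrib_left)
    finally show ?thesis .
  qed
  have "(shift_sum (insert b A) ^^ Suc j) u \<gamma> =
     (\<Sum>m\<le>j. real (j choose m) * T m (Suc j - m)) + (\<Sum>m\<le>j. real (j choose m) * T (Suc m) (j - m))"
    using assms by (simp add: shift_sum_def[of "insert b A"] flip: A b)
  \<comment> \<open>The added term is zero because \<open>j choose Suc j\<close> is; with it the sum
    can be reindexed to match the second one.\<close>
  also have "(\<Sum>m\<le>j. real (j choose m) * T m (Suc j - m)) = (\<Sum>m\<le>Suc j. real (j choose m) * T m (Suc j - m))"
    by (simp add: binomial_eq_0)
  also have "\<dots> = T 0 (Suc j) + (\<Sum>m\<le>j. real (j choose Suc m) * T (Suc m) (j - m))"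
    by (subst sum.atMost_Suc_shift) simp
  also have "\<dots> + (\<Sum>m\<le>j. real (j choose m) * T (Suc m) (j - m)) =
      T 0 (Suc j) + (\<Sum>m\<le>j. real (Suc j choose Suc m) * T (Suc m) (j - m))"
    by (simp add: sum.distrib[symmetric] algebra_simps)
  also have "\<dots> = (\<Sum>m\<le>Suc j. real (Suc j choose m) * T m (Suc j - m))"
    by (subst sum.atMost_Suc_shift) simp
  finally show ?case unfolding T_def .
qed

text \<open>At the relevant level \<open>shift_sum (J \<union> Z) u\<close> is nearly zero, so a
  factor \<open>shift_sum J\<close> can be traded for minus \<open>shift_sum Z\<close>. Each of the
  \<open>b\<close> trades costs at most \<open>n ^ j * \<epsilon>\<close>.\<close>

lemma shift_sum_pow_transfer:
  assumes "finite J" "finite Z" "J \<inter> Z = {}" "card (J \<union> Z) \<le> n" "1 \<le> n"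
    and small: "\<And>\<beta>. (\<And>i. i \<notin> J \<union> Z \<Longrightarrow> \<beta> i = \<gamma> i) \<Longrightarrow> Suc (sum \<beta> (J \<union> Z)) = sum \<gamma> (J \<union> Z) + j
        \<Longrightarrow> \<bar>shift_sum (J \<union> Z) u \<beta>\<bar> \<le> \<epsilon>"
    and "0 \<le> \<epsilon>" "j = a + b"
  shows "\<bar>(shift_sum J ^^ j) u \<gamma>\<bar> \<le> \<bar>(shift_sum J ^^ a) ((shift_sum Z ^^ b) u) \<gamma>\<bar> + real b * real n ^ j * \<epsilon>"
  using \<open>j = a + b\<close>
proof (induction b arbitrary: a)
  case 0
  then show ?case by simp
next
  case (Suc b)
  let ?v = "(shift_sum J ^^ a) ((shift_sum Z ^^ b) (shift_sum (J \<union> Z) u)) \<gamma>"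
  have "shift_sum J v \<gamma> + shift_sum Z v \<gamma> = shift_sum (J \<union> Z) v \<gamma>" for v \<gamma>
    using assms by (simp add: shift_sum_def sum.union_disjoint)
  then have "(shift_sum J ^^ Suc a) ((shift_sum Z ^^ b) u) \<gamma> +
      (shift_sum J ^^ a) ((shift_sum Z ^^ Suc b) u) \<gamma> = ?v"
    by (simp add: shift_sum_pow_commute)
  then have 1: "\<bar>(shift_sum J ^^ Suc a) ((shift_sum Z ^^ b) u) \<gamma>\<bar> \<le>
      \<bar>(shift_sum J ^^ a) ((shift_sum Z ^^ Suc b) u) \<gamma>\<bar> + \<bar>?v\<bar>"
    by linarith
  have "\<bar>?v\<bar> \<le> real (card J) ^ a * (real (card Z) ^ b * \<epsilon>)"
  proof (intro shift_sum_pow_bound assms(1,2))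
    \<comment> \<open>Only \<open>a + b = j - 1\<close> shifts are used up here; the remaining one
      is \<open>shift_sum (J \<union> Z)\<close> itself, which accounts for the \<open>Suc\<close>
      in \<open>small\<close>.\<close>
    fix \<delta> \<delta>' assume d: "\<delta> \<in> compositions J a" "\<delta>' \<in> compositions Z b"
    have "sum \<delta> (J \<union> Z) = a" "sum \<delta>' (J \<union> Z) = b"
      using d assms(1-3) by (auto simp: compositions_def sum.union_disjoint intro!: sum.neutral)
    then show "\<bar>shift_sum (J \<union> Z) u (\<gamma> + \<delta> + \<delta>')\<bar> \<le> \<epsilon>"
      using d Suc.prems by (intro small) (auto simp: compositions_def plus_fun_def sum.distrib)
  qed
  also have "\<dots> \<le> real n ^ a * (real n ^ b * \<epsilon>)"
    using assms by (intro mult_mono power_mono mult_right_mono)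
      (auto simp: card_Un_disjoint)
  also have "\<dots> = real n ^ (a + b) * \<epsilon>"
    by (simp add: power_add)
  also have "\<dots> \<le> real n ^ j * \<epsilon>"
    using Suc.prems assms by (intro mult_right_mono power_increasing) auto
  finally have "\<bar>?v\<bar> \<le> real n ^ j * \<epsilon>" .
  with 1 Suc.IH[of "Suc a"] Suc.prems show ?case
    by (simp add: algebra_simps)
qed

section \<open>Quantitative interpolation for polynomials in Newton form\<close>

lemma lagrange_interpolation:
  fixes p :: "'a :: field poly"
  assumes "finite X" "degree p < card X"
  shows "poly p y = (\<Sum>x\<in>X. poly p x * (\<Prod>z\<in>X - {x}. (y - z) / (x - z)))"
proof -
  define q where "q = (\<Sum>x\<in>X. smult (poly p x) (\<Prod>z\<in>X - {x}. smult (1 / (x - z)) [:- z, 1:]))"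
  have q: "poly q y = (\<Sum>x\<in>X. poly p x * (\<Prod>z\<in>X - {x}. (y - z) / (x - z)))" for y
    unfolding q_def by (simp add: poly_sum poly_prod diff_divide_distrib)
  have "degree (\<Prod>z\<in>X - {x}. smult (1 / (x - z)) [:- z, 1:]) \<le> card X - 1" if "x \<in> X" for x
  proof -
    have "degree (\<Prod>z\<in>X - {x}. smult (1 / (x - z)) [:- z, 1:]) \<le>
        (\<Sum>z\<in>X - {x}. degree (smult (1 / (x - z)) [:- z, 1:]))"
      using degree_prod_sum_le[of "X - {x}" "\<lambda>z. smult (1 / (x - z)) [:- z, 1:]"] assms
      by (simp add: o_def)
    also have "\<dots> \<le> (\<Sum>z\<in>X - {x}. 1)"
      by (intro sum_mono) auto
    finally show ?thesis using that assms by simp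
  qed
  then have "degree q \<le> card X - 1"
    unfolding q_def using assms
    by (intro degree_sum_le) (auto intro: order_trans[OF degree_smult_le])
  moreover have "poly (p - q) x = 0" if "x \<in> X" for x
  proof -
    have "poly q x = (\<Sum>x'\<in>X. if x' = x then poly p x else 0)"
      unfolding q
    proof (intro sum.cong refl)
      fix x' assume "x' \<in> X"
      show "poly p x' * (\<Prod>z\<in>X - {x'}. (x - z) / (x' - z)) = (if x' = x then poly p x else 0)"
      proof (cases "x' = x")
        case True
        have "(\<Prod>z\<in>X - {x}. (x - z) / (x - z)) = 1"
          by (intro prod.neutral) auto
        with True show ?thesis by simp
      next
        case False
        then have "(\<Prod>z\<in>X - {x'}. (x - z) / (x' - z)) = 0"
          using assms that by (intro prod_zero) auto
        with False show ?thesis by simp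
      qed
    qed
    then show ?thesis using that assms by simp
  qed
  moreover have "degree (p - q) < card X"
    using assms \<open>degree q \<le> card X - 1\<close> by (intro le_less_trans[OF degree_diff_le_max]) auto
  \<comment> \<open>The difference has degree below \<open>card X\<close> and yet vanishes on
    \<open>X\<close>.\<close>
  ultimately have "p - q = 0"
  proof (intro ccontr[of "p - q = 0"])
    assume X: "\<And>x. x \<in> X \<Longrightarrow> poly (p - q) x = 0" and deg: "degree (p - q) < card X" and "p - q \<noteq> 0"
    then have "card X \<le> card {x. poly (p - q) x = 0}"
      by (intro card_mono poly_roots_finite) auto
    also have "\<dots> \<le> degree (p - q)"
      by (rule card_poly_roots_bound) fact
    finally show False using deg by simp
  qed
  then have "poly p y = poly q y" by simp
  then show ?thesis unfolding q .
qed

text \<open>The largest of \<open>m\<close> distinct positive integers is at least \<open>m\<close>;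
  remove it and induct.\<close>

lemma fact_card_le_prod:
  fixes Y :: "nat set"
  assumes "finite Y" "0 \<notin> Y"
  shows "fact (card Y) \<le> \<Prod>Y"
  using assms
proof (induction Y rule: finite_linorder_max_induct)
  case (insert b A)
  have "insert b A \<subseteq> {1..b}"
  proof
    fix x assume x: "x \<in> insert b A"
    then have "x \<le> b" using insert by (auto intro: less_imp_le)
    moreover have "x \<noteq> 0" using x insert.prems by metis
    ultimately show "x \<in> {1..b}" by simp
  qed
  then have "card (insert b A) \<le> b"
    using card_mono[of "{1..b}"] by simp
  moreover have "card (insert b A) = Suc (card A)" "b \<notin> A"
    using insert by auto
  ultimately show ?case
    using insert mult_le_mono[of "Suc (card A)" b "fact (card A)" "\<Prod>A"] by simp
qed simp

text \<open>Bounds the denominators in Lagrange's formula. The distances from \<open>x\<close> to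
  the points on one side are distinct positive integers, so each side contributes at least a
  factorial; the two factorials fall short of \<open>fact D\<close> by a binomial coefficient, which
  is at most \<open>2 ^ D\<close>.\<close>

lemma fact_le_prod_diff:
  fixes X :: "nat set"
  assumes "finite X" "x \<in> X" "card X = Suc D"
  shows "fact D / 2 ^ D \<le> (\<Prod>z\<in>X - {x}. \<bar>real x - real z\<bar>)"
proof -
  define L where "L = {z \<in> X. z < x}"
  define U where "U = {z \<in> X. x < z}"
  have X: "X - {x} = L \<union> U" "L \<inter> U = {}" "finite L" "finite U"
    using assms by (auto simp: L_def U_def)
  then have D: "card L + card U = D"
    using assms card_Un_disjoint[of L U] card_Diff_singleton[of x X] by simp
  have "fact (card L) \<le> (\<Prod>z\<in>L. \<bar>real x - real z\<bar>)"
  proof -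
    have i: "inj_on (\<lambda>z. x - z) L" by (auto simp: inj_on_def L_def)
    have "fact (card L) \<le> \<Prod>((\<lambda>z. x - z) ` L)"
      using X fact_card_le_prod[of "(\<lambda>z. x - z) ` L"] card_image[OF i] by (force simp: L_def)
    also have "\<dots> = (\<Prod>z\<in>L. x - z)" by (simp add: prod.reindex[OF i])
    finally have "real (fact (card L)) \<le> real (\<Prod>z\<in>L. x - z)" by (simp only: of_nat_le_iff)
    also have "\<dots> = (\<Prod>z\<in>L. \<bar>real x - real z\<bar>)"
      unfolding of_nat_prod by (intro prod.cong) (auto simp: L_def)
    finally show ?thesis by simp
  qed
  moreover have "fact (card U) \<le> (\<Prod>z\<in>U. \<bar>real x - real z\<bar>)"
  proof -
    have i: "inj_on (\<lambda>z. z - x) U" by (auto simp: inj_on_def U_def)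
    have "fact (card U) \<le> \<Prod>((\<lambda>z. z - x) ` U)"
      using X fact_card_le_prod[of "(\<lambda>z. z - x) ` U"] card_image[OF i] by (force simp: U_def)
    also have "\<dots> = (\<Prod>z\<in>U. z - x)" by (simp add: prod.reindex[OF i])
    finally have "real (fact (card U)) \<le> real (\<Prod>z\<in>U. z - x)" by (simp only: of_nat_le_iff)
    also have "\<dots> = (\<Prod>z\<in>U. \<bar>real x - real z\<bar>)"
      unfolding of_nat_prod by (intro prod.cong) (auto simp: U_def)
    finally show ?thesis by simp
  qed
  moreover have "fact D / 2 ^ D \<le> (fact (card L) * fact (card U) :: real)"
  proof -
    have "fact D = fact (card L) * fact (card U) * real (D choose card L)"
      using binomial_fact_lemma[of "card L" D] D by (metis add_diff_cancel_left' le_add1 of_nat_fact of_nat_mult)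
    also have "\<dots> \<le> fact (card L) * fact (card U) * 2 ^ D"
      using binomial_le_pow2[of D "card L"] by (intro mult_left_mono) (simp_all flip: of_nat_le_iff)
    finally show ?thesis by (simp add: divide_simps)
  qed
  ultimately have "fact D / 2 ^ D \<le> (\<Prod>z\<in>L. \<bar>real x - real z\<bar>) * (\<Prod>z\<in>U. \<bar>real x - real z\<bar>)"
    by (elim order_trans) (intro mult_mono, simp_all add: prod_nonneg)
  then show ?thesis
    unfolding X(1) using X(2-4) by (simp add: prod.union_disjoint)
qed

text \<open>Newton's form of a polynomial in \<open>j\<close>: for \<open>m \<le> D\<close> the
  coefficient \<open>a m\<close> is the \<open>m\<close>-th forward difference at 0.\<close>

definition newton_sum :: "nat \<Rightarrow> (nat \<Rightarrow> real) \<Rightarrow> nat \<Rightarrow> real" where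
  "newton_sum D a j = (\<Sum>m\<le>D. real (j choose m) * a m)"

text \<open>Each forward difference at most doubles the bound on the values, and \<open>a k\<close>
  is reached after \<open>k\<close> of them.\<close>

lemma newton_coeff_le:
  assumes "\<And>j. j \<le> k \<Longrightarrow> \<bar>newton_sum D a j\<bar> \<le> M" "k \<le> D"
  shows "\<bar>a k\<bar> \<le> 2 ^ k * M"
  using assms
proof (induction k arbitrary: a D M)
  case 0
  have "newton_sum D a 0 = (\<Sum>m\<le>D. if m = 0 then a m else 0)"
    unfolding newton_sum_def by (intro sum.cong) auto
  with 0 show ?case by simp
next
  case (Suc k)
  then obtain D' where D: "D = Suc D'" by (cases D) auto
  have "\<bar>newton_sum D' (\<lambda>m. a (Suc m)) j\<bar> \<le> 2 * M" if "j \<le> k" for j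
  proof -
    \<comment> \<open>By Pascal's rule, differencing drops the constant term and moves the
      coefficients down by one.\<close>
    have "newton_sum D a (Suc j) - newton_sum D a j = newton_sum D' (\<lambda>m. a (Suc m)) j"
      unfolding newton_sum_def D sum.atMost_Suc_shift
      by (simp add: algebra_simps sum.distrib)
    with Suc.prems(1)[of j] Suc.prems(1)[of "Suc j"] that show ?thesis by linarith
  qed
  then have "\<bar>a (Suc k)\<bar> \<le> 2 ^ k * (2 * M)"
    using Suc.prems(2) D by (intro Suc.IH[where a = "\<lambda>m. a (Suc m)" and D = D']) auto
  then show ?case by simp
qed

lemma newton_sum_poly: "\<exists>p. degree p \<le> D \<and> (\<forall>j. poly p (real j) = newton_sum D a j)"
proof -
  define p where "p = (\<Sum>m\<le>D. smult (a m / fact m) (\<Prod>i<m. [:- real i, 1:]))"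
  have "degree (\<Prod>i<m. [:- real i, 1:]) \<le> m" for m
    using degree_prod_sum_le[of "{..<m}" "\<lambda>i. [:- real i, 1:]"] by simp
  then have "degree p \<le> D"
    unfolding p_def by (intro degree_sum_le) (auto intro: order_trans[OF degree_smult_le] order_trans)
  moreover have "poly p (real j) = newton_sum D a j" for j
    unfolding p_def newton_sum_def
    by (simp add: poly_sum poly_prod binomial_gbinomial gbinomial_prod_rev atLeast0LessThan mult.commute)
  ultimately show ?thesis by blast
qed

text \<open>The nodes may be any \<open>D + 1\<close> integers in the interval: extrapolating from
  them to \<open>0, ..., k\<close> costs only a factor exponential in \<open>L\<close>, and then
  \<open>newton_coeff_le\<close> applies.\<close>

lemma newton_coeff_le_of_small_values:
  assumes "card X = Suc D" "X \<subseteq> {k..L}" "k \<le> D" "k \<le> L"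
    and small: "\<And>x. x \<in> X \<Longrightarrow> \<bar>newton_sum D a x\<bar> \<le> \<eta>"
  shows "\<bar>a k\<bar> \<le> 2 ^ k * (4 ^ D * exp (real L) * \<eta>)"
proof (rule newton_coeff_le[OF _ \<open>k \<le> D\<close>])
  fix y assume "y \<le> k"
  obtain p where p: "degree p \<le> D" "\<And>j. poly p (real j) = newton_sum D a j"
    using newton_sum_poly[of D a] by blast
  have fin: "finite X" and ne: "X \<noteq> {}"
    using assms(1) by (auto intro: card_ge_0_finite)
  then obtain x0 where "x0 \<in> X" by blast
  have "0 \<le> \<eta>" using small[OF \<open>x0 \<in> X\<close>] by simp
  have X': "card (real ` X) = Suc D"
    using assms(1) by (simp add: card_image)
  have "\<bar>newton_sum D a y\<bar> = \<bar>\<Sum>x\<in>real ` X. poly p x * (\<Prod>z\<in>real ` X - {x}. (real y - z) / (x - z))\<bar>"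
    using lagrange_interpolation[of "real ` X" p "real y"] fin p X' by simp
  also have "\<dots> = \<bar>\<Sum>x\<in>X. newton_sum D a x * (\<Prod>z\<in>X - {x}. (real y - real z) / (real x - real z))\<bar>"
  proof (subst sum.reindex, simp, rule arg_cong[where f = abs], rule sum.cong)
    fix x assume "x \<in> X"
    have "real ` X - {real x} = real ` (X - {x})" by auto
    then show "((\<lambda>x. poly p x * (\<Prod>z\<in>real ` X - {x}. (real y - z) / (x - z))) \<circ> real) x =
      newton_sum D a x * (\<Prod>z\<in>X - {x}. (real y - real z) / (real x - real z))"
      by (simp add: p prod.reindex)
  qed simp
  also have "\<dots> \<le> (\<Sum>x\<in>X. \<bar>newton_sum D a x\<bar> * \<bar>\<Prod>z\<in>X - {x}. (real y - real z) / (real x - real z)\<bar>)"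
    by (intro order_trans[OF sum_abs]) (simp add: abs_mult)
  also have "\<dots> \<le> (\<Sum>x\<in>X. \<eta> * (2 ^ D * exp (real L)))"
  proof (intro sum_mono mult_mono small)
    fix x assume x: "x \<in> X"
    have "\<bar>\<Prod>z\<in>X - {x}. (real y - real z) / (real x - real z)\<bar> =
        (\<Prod>z\<in>X - {x}. \<bar>real y - real z\<bar>) / (\<Prod>z\<in>X - {x}. \<bar>real x - real z\<bar>)"
      by (simp add: abs_prod prod_dividef)
    \<comment> \<open>Both \<open>y\<close> and the nodes lie in \<open>{0..L}\<close>, so every
      factor of the numerator is at most \<open>L\<close>.\<close>
    also have "\<dots> \<le> real L ^ D / (fact D / 2 ^ D)"
    proof (rule frac_le)
      show "0 < (fact D / 2 ^ D :: real)" by simp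
      show "fact D / 2 ^ D \<le> (\<Prod>z\<in>X - {x}. \<bar>real x - real z\<bar>)"
        using fact_le_prod_diff[OF fin x assms(1)] .
      have "(\<Prod>z\<in>X - {x}. \<bar>real y - real z\<bar>) \<le> (\<Prod>z\<in>X - {x}. real L)"
        using assms \<open>y \<le> k\<close> by (intro prod_mono) force
      then show "(\<Prod>z\<in>X - {x}. \<bar>real y - real z\<bar>) \<le> real L ^ D"
        using x assms(1) fin by simp
    qed simp
    also have "\<dots> = 2 ^ D * (real L ^ D / fact D)" by simp
    also have "real L ^ D / fact D \<le> exp (real L)"
    proof -
      have "(\<Sum>n\<in>{D}. real L ^ n / fact n) \<le> exp (real L)"
        using sum_le_suminf[OF summable_exp[of "real L"], of "{D}"]
        by (simp add: exp_def divide_inverse mult.commute)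
      then show ?thesis by simp
    qed
    finally show "\<bar>\<Prod>z\<in>X - {x}. (real y - real z) / (real x - real z)\<bar> \<le> 2 ^ D * exp (real L)"
      by (simp add: mult_left_mono)
  qed (use \<open>0 \<le> \<eta>\<close> in auto)
  also have "\<dots> = real (Suc D) * 2 ^ D * exp (real L) * \<eta>"
    using assms(1) by simp
  also have "\<dots> \<le> 2 ^ D * 2 ^ D * exp (real L) * \<eta>"
  proof -
    have "Suc D \<le> 2 ^ D" by (induction D) auto
    then have "real (Suc D) \<le> 2 ^ D" by (metis of_nat_le_iff of_nat_numeral of_nat_power)
    then show ?thesis using \<open>0 \<le> \<eta>\<close> by (intro mult_right_mono) auto
  qed
  finally show "\<bar>newton_sum D a y\<bar> \<le> 4 ^ D * exp (real L) * \<eta>"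
    by (simp flip: power_mult_distrib)
qed

section \<open>Lower bound for the number of shifts with a large result\<close>

definition bounded_funs :: "nat set \<Rightarrow> nat \<Rightarrow> (nat \<Rightarrow> nat) set" where
  "bounded_funs J e = {c. (\<forall>i. i \<notin> J \<longrightarrow> c i = 0) \<and> (\<forall>i\<in>J. c i \<le> e)}"

text \<open>There are as many shifts as units subtracted, so for \<open>c \<le> q\<close> only
  points with the coordinate sum of \<open>q\<close> are evaluated. The allowed loss of
  \<open>5 * e\<close> per coordinate in the exponent is what one induction step over
  \<open>J\<close> consumes.\<close>

definition good_shifts :: "nat set \<Rightarrow> nat \<Rightarrow> ((nat \<Rightarrow> nat) \<Rightarrow> real) \<Rightarrow> (nat \<Rightarrow> nat) \<Rightarrow> (nat \<Rightarrow> nat) set" where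
  "good_shifts J e u q = {c \<in> bounded_funs J e.
     exp (- 5 * real (card J) * real e) * \<bar>u q\<bar> \<le> \<bar>(shift_sum J ^^ sum c J) u (\<lambda>i. q i - c i)\<bar>}"

lemma finite_bounded_funs: "finite J \<Longrightarrow> finite (bounded_funs J e)"
proof -
  assume "finite J"
  then have "finite {f. \<forall>x. (x \<in> J \<longrightarrow> f x \<in> {0..e}) \<and> (x \<notin> J \<longrightarrow> f x = 0)}"
    by (rule finite_set_of_finite_funs) simp
  then show ?thesis
    by (rule rev_finite_subset) (auto simp: bounded_funs_def)
qed

lemma finite_good_shifts: "finite J \<Longrightarrow> finite (good_shifts J e u q)"
  unfolding good_shifts_def by (rule finite_subset[OF _ finite_bounded_funs[of J e]]) auto

text \<open>
  Moving away from \<open>q\<close> with first changed coordinate \<open>b\<close> decreased by a fixed fraction of \<open>e\<close> makes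
  \<open>u\<close> exponentially small, since \<open>lam b\<close> outweighs everything that the coordinates after \<open>b\<close> can contribute.
\<close>

definition exp_growth :: "nat \<Rightarrow> (nat \<Rightarrow> real) \<Rightarrow> nat set \<Rightarrow> nat \<Rightarrow> ((nat \<Rightarrow> nat) \<Rightarrow> real) \<Rightarrow> (nat \<Rightarrow> nat) \<Rightarrow> bool" where
  "exp_growth n lam J e u q \<longleftrightarrow> finite J \<and> card J \<le> n \<and> 1 \<le> n \<and> (\<forall>i\<in>J. e \<le> q i) \<and> (\<forall>i\<in>J. 0 \<le> lam i) \<and>
     (\<forall>b\<in>J. 8 + 28 * real n + 16 * (\<Sum>l\<in>{l \<in> J. b < l}. lam l) \<le> lam b) \<and>
     (\<forall>\<alpha>. (\<forall>i. i \<notin> J \<longrightarrow> \<alpha> i = q i) \<longrightarrow> sum \<alpha> J = sum q J \<longrightarrow> (\<forall>i\<in>J. q i \<le> \<alpha> i + e) \<longrightarrow>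
        \<bar>u \<alpha>\<bar> \<le> \<bar>u q\<bar> * exp (\<Sum>i\<in>J. lam i * (real (\<alpha> i) - real (q i))))"

lemma power_le_exp: "0 \<le> x \<Longrightarrow> x \<le> exp y \<Longrightarrow> x ^ k \<le> exp (real k * y)" for x y :: real
  by (simp add: exp_of_nat_mult power_mono)

text \<open>
  Up to an exponentially small error, the shifted sum is a polynomial in \<open>x\<close> of degree at most \<open>D\<close>, where
  \<open>D \<le> e / 2\<close>. One of its Newton coefficients is the large number provided by \<open>c'\<close>, so it cannot be small at
  more than \<open>D\<close> points.
\<close>

lemma exp_growth_fiber:
  assumes g: "exp_growth n lam (insert b A) e u q" and b: "\<forall>a\<in>A. b < a" and "1 \<le> e"
    and c': "c' \<in> good_shifts A (e div (4 * n)) u q"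
  shows "real e + 1 \<le> 2 * real (card {x \<in> {0..e}. c'(b := x) \<in> good_shifts (insert b A) e u q})"
proof -
  \<comment> \<open>The divisor \<open>4 * n\<close> forces \<open>4 * \<kappa> \<le> e\<close> and
    hence \<open>2 * D \<le> e\<close>.\<close>
  define e' where "e' = e div (4 * n)"
  define \<kappa> where "\<kappa> = sum c' A"
  define D where "D = \<kappa> + e div 4"
  define w where "w = (\<lambda>i. q i - c' i)"
  define a where "a m = (shift_sum A ^^ m) u (w(b := q b + \<kappa> - m))" for m
  define val where "val x = (shift_sum (insert b A) ^^ (x + \<kappa>)) u (w(b := q b - x))" for x
  define \<eta> where "\<eta> = exp (- 5 * (real (card A) + 1) * real e)"
  define bad where "bad = {x \<in> {0..e}. \<bar>val x\<bar> < \<eta> * \<bar>u q\<bar>}"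
  have fin: "finite A" and bA: "b \<notin> A" and n: "1 \<le> n" "card A + 1 \<le> n"
    and eq: "e \<le> q b" "\<And>i. i \<in> A \<Longrightarrow> e \<le> q i"
    using g b by (auto simp: exp_growth_def)
  have lam0: "0 \<le> lam i" if "i \<in> A" for i
    using g that by (auto simp: exp_growth_def)
  have "{l \<in> insert b A. b < l} = A"
    using b by auto
  then have lamb: "8 + 28 * real n + 16 * (\<Sum>l\<in>A. lam l) \<le> lam b"
    using g by (auto simp: exp_growth_def)
  have growth: "\<bar>u \<alpha>\<bar> \<le> \<bar>u q\<bar> * exp (lam b * (real (\<alpha> b) - real (q b)) + (\<Sum>i\<in>A. lam i * (real (\<alpha> i) - real (q i))))"
    if "\<And>i. i \<notin> insert b A \<Longrightarrow> \<alpha> i = q i" "\<alpha> b + sum \<alpha> A = q b + sum q A"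
      "q b \<le> \<alpha> b + e" "\<And>i. i \<in> A \<Longrightarrow> q i \<le> \<alpha> i + e" for \<alpha>
  proof -
    have "\<bar>u \<alpha>\<bar> \<le> \<bar>u q\<bar> * exp (\<Sum>i\<in>insert b A. lam i * (real (\<alpha> i) - real (q i)))"
      using g that fin bA unfolding exp_growth_def by auto
    then show ?thesis using fin bA by simp
  qed
  have c'0: "\<And>i. i \<notin> A \<Longrightarrow> c' i = 0" and c'e: "\<And>i. i \<in> A \<Longrightarrow> c' i \<le> e'"
    and c'good: "exp (- 5 * real (card A) * real e') * \<bar>u q\<bar> \<le> \<bar>(shift_sum A ^^ \<kappa>) u w\<bar>"
    using c' by (auto simp: good_shifts_def bounded_funs_def e'_def \<kappa>_def w_def)
  have e'e: "e' \<le> e" by (simp add: e'_def)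
  have "\<kappa> \<le> card A * e'"
    unfolding \<kappa>_def using sum_bounded_above[of A c' e'] c'e by simp
  also have "\<dots> \<le> n * e'"
    using n by (intro mult_le_mono1) simp
  finally have "4 * \<kappa> \<le> 4 * n * e'" by simp
  also have "\<dots> \<le> e"
    unfolding e'_def by (rule times_div_less_eq_dividend)
  finally have "4 * \<kappa> \<le> e" .
  then have D: "2 * D \<le> e" "\<kappa> \<le> D" unfolding D_def by auto

  \<comment> \<open>In the term with index \<open>m\<close> the coordinate \<open>b\<close> ends at
    \<open>q b + \<kappa> - m\<close> whatever \<open>x\<close> is. So the coefficients
    \<open>a m\<close> do not depend on \<open>x\<close>, and this is a Newton expansion in
    \<open>x + \<kappa>\<close>.\<close>
  have val: "val x = (\<Sum>m\<le>x + \<kappa>. real (x + \<kappa> choose m) * a m)" if "x \<le> e" for x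
    unfolding val_def shift_sum_pow_insert[OF fin bA] a_def
  proof (intro sum.cong refl arg_cong2[where f = "(*)"] arg_cong[where f = "(shift_sum A ^^ _) u"])
    fix m assume "m \<in> {..x + \<kappa>}"
    then show "(w(b := q b - x))(b := (w(b := q b - x)) b + (x + \<kappa> - m)) = w(b := q b + \<kappa> - m)"
      using that eq(1) by (simp add: fun_eq_iff)
  qed

  have a_small: "\<bar>a m\<bar> \<le> exp (- (2 + 5 * real n) * real e) * \<bar>u q\<bar>" if m: "D < m" "m \<le> e + \<kappa>" for m
  proof -
    have m2: "m \<le> 2 * e"
      using m D by linarith
    have "e + 4 * \<kappa> \<le> 4 * m"
      using m unfolding D_def by linarith
    then have "real (e + 4 * \<kappa>) \<le> real (4 * m)" by (simp only: of_nat_le_iff)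
    then have mD: "real e \<le> 4 * (real m - real \<kappa>)" by simp
    have "\<bar>a m\<bar> \<le> real (card A) ^ m * (\<bar>u q\<bar> * exp (- (2 + 7 * real n) * real e))"
      unfolding a_def
    proof (rule shift_sum_pow_bound[OF fin])
      fix \<delta> assume \<delta>: "\<delta> \<in> compositions A m"
      define \<alpha> where "\<alpha> = w(b := q b + \<kappa> - m) + \<delta>"
      have \<delta>0: "\<And>i. i \<notin> A \<Longrightarrow> \<delta> i = 0" and \<delta>m: "sum \<delta> A = m"
        using \<delta> by (auto simp: compositions_def)
      have \<alpha>b: "\<alpha> b = q b + \<kappa> - m" and \<alpha>A: "\<And>i. i \<in> A \<Longrightarrow> \<alpha> i = q i - c' i + \<delta> i"
        using bA \<delta>0 by (auto simp: \<alpha>_def w_def)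
      have sA: "sum \<alpha> A = sum q A - \<kappa> + m"
      proof -
        have "sum \<alpha> A = (\<Sum>i\<in>A. q i - c' i) + m"
          unfolding \<delta>m[symmetric] sum.distrib[symmetric] by (intro sum.cong) (auto simp: \<alpha>A)
        also have "(\<Sum>i\<in>A. q i - c' i) = sum q A - \<kappa>"
          unfolding \<kappa>_def by (intro sum_subtractf_nat) (use c'e eq e'e in force)
        finally show ?thesis .
      qed
      have "\<kappa> \<le> sum q A"
        unfolding \<kappa>_def by (intro sum_mono) (use c'e eq e'e in force)
      have "\<bar>u \<alpha>\<bar> \<le> \<bar>u q\<bar> * exp (lam b * (real (\<alpha> b) - real (q b)) + (\<Sum>i\<in>A. lam i * (real (\<alpha> i) - real (q i))))"
      proof (rule growth)
        show "\<alpha> b + sum \<alpha> A = q b + sum q A"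
          using \<open>\<kappa> \<le> sum q A\<close> sA \<alpha>b m eq by linarith
        show "q b \<le> \<alpha> b + e" using \<alpha>b m eq by linarith
        show "q i \<le> \<alpha> i + e" if "i \<in> A" for i
          using \<alpha>A[OF that] c'e[OF that] e'e by linarith
      qed (auto simp: \<alpha>_def w_def c'0 \<delta>0)
      \<comment> \<open>As \<open>m > D\<close>, coordinate \<open>b\<close> drops by at least
        \<open>e / 4\<close>, which contributes at most \<open>- (2 + 7 * n) * e\<close> minus
        \<open>4 * e\<close> times the sum of \<open>lam\<close> over \<open>A\<close>. The
        coordinates in \<open>A\<close> rise by at most \<open>2 * e\<close> each, which recovers at
        most half of the last term.\<close>
      also have "lam b * (real (\<alpha> b) - real (q b)) + (\<Sum>i\<in>A. lam i * (real (\<alpha> i) - real (q i))) \<le>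
          - (2 + 7 * real n) * real e"
      proof -
        have "(\<Sum>i\<in>A. lam i * (real (\<alpha> i) - real (q i))) \<le> (\<Sum>i\<in>A. lam i * (2 * real e))"
        proof (intro sum_mono mult_left_mono lam0)
          fix i assume i: "i \<in> A"
          have "\<delta> i \<le> m" using member_le_sum[of i A \<delta>] fin i \<delta>m by simp
          then show "real (\<alpha> i) - real (q i) \<le> 2 * real e"
            using \<alpha>A[OF i] m2 by linarith
        qed
        also have "\<dots> = 2 * real e * (\<Sum>i\<in>A. lam i)"
          by (simp add: sum_distrib_right mult.commute)
        finally have 1: "(\<Sum>i\<in>A. lam i * (real (\<alpha> i) - real (q i))) \<le> 2 * real e * (\<Sum>i\<in>A. lam i)" .
        have S: "0 \<le> (\<Sum>i\<in>A. lam i)" using lam0 by (rule sum_nonneg)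
        have "\<alpha> b + m = q b + \<kappa>"
          using \<alpha>b m eq(1) by linarith
        then have "real (\<alpha> b + m) = real (q b + \<kappa>)" by simp
        then have "real (\<alpha> b) - real (q b) \<le> - (real e / 4)"
          using mD by simp
        then have "lam b * (real (\<alpha> b) - real (q b)) \<le> lam b * (- (real e / 4))"
          using lamb S by (intro mult_left_mono) auto
        also have "\<dots> \<le> (8 + 28 * real n + 16 * (\<Sum>l\<in>A. lam l)) * (- (real e / 4))"
          using lamb by (intro mult_right_mono_neg) auto
        also have "\<dots> = - (2 + 7 * real n) * real e - 4 * (real e * (\<Sum>l\<in>A. lam l))"
          by (simp add: field_simps)
        finally show ?thesis
          using 1 mult_nonneg_nonneg[of "real e", OF _ S] by linarith
      qed
      finally show "\<bar>u (w(b := q b + \<kappa> - m) + \<delta>)\<bar> \<le> \<bar>u q\<bar> * exp (- (2 + 7 * real n) * real e)"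
        by (simp add: \<alpha>_def mult_left_mono)
    qed
    \<comment> \<open>The number of terms absorbs \<open>2 * n * e\<close> of the exponent, turning
      \<open>7 * n\<close> into \<open>5 * n\<close>.\<close>
    also have "\<dots> \<le> exp (2 * real e * real n) * (\<bar>u q\<bar> * exp (- (2 + 7 * real n) * real e))"
    proof (rule mult_right_mono)
      have "real (card A) ^ m \<le> real n ^ (2 * e)"
        using n m2 by (intro order_trans[OF power_mono power_increasing]) auto
      also have "\<dots> \<le> exp (real (2 * e) * real n)"
        using exp_ge_add_one_self[of "real n"] by (intro power_le_exp, simp, linarith)
      finally show "real (card A) ^ m \<le> exp (2 * real e * real n)" by simp
    qed simp
    also have "\<dots> = exp (2 * real e * real n + - (2 + 7 * real n) * real e) * \<bar>u q\<bar>"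
      unfolding exp_add by (simp only: mult_ac)
    also have "2 * real e * real n + - (2 + 7 * real n) * real e = - (2 + 5 * real n) * real e"
      by (simp add: algebra_simps)
    finally show ?thesis .
  qed

  \<comment> \<open>The binomial coefficients of the discarded terms add up to at most
    \<open>2 ^ (2 * e)\<close>, which absorbs the remaining \<open>2 * e\<close>.\<close>
  have approx: "\<bar>val x - newton_sum D a (x + \<kappa>)\<bar> \<le> \<eta> * \<bar>u q\<bar>" if "x \<le> e" for x
  proof -
    let ?f = "\<lambda>m. real (x + \<kappa> choose m) * a m"
    have "val x = sum ?f ({..D} \<union> {D<..x + \<kappa>})"
      unfolding val[OF that] by (rule sum.mono_neutral_left) (auto simp: binomial_eq_0)
    also have "\<dots> = newton_sum D a (x + \<kappa>) + sum ?f {D<..x + \<kappa>}"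
      by (subst sum.union_disjoint) (auto simp: newton_sum_def)
    finally have "\<bar>val x - newton_sum D a (x + \<kappa>)\<bar> \<le> (\<Sum>m\<in>{D<..x + \<kappa>}. \<bar>?f m\<bar>)"
      by (simp add: sum_abs)
    also have "\<dots> \<le> (\<Sum>m\<in>{D<..x + \<kappa>}. real (x + \<kappa> choose m) * (exp (- (2 + 5 * real n) * real e) * \<bar>u q\<bar>))"
      unfolding abs_mult using that by (intro sum_mono mult_mono a_small) auto
    also have "\<dots> = (\<Sum>m\<in>{D<..x + \<kappa>}. real (x + \<kappa> choose m)) * (exp (- (2 + 5 * real n) * real e) * \<bar>u q\<bar>)"
      by (simp add: sum_distrib_right)
    also have "\<dots> \<le> exp (2 * real e) * (exp (- (2 + 5 * real n) * real e) * \<bar>u q\<bar>)"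
    proof (rule mult_right_mono)
      have "(\<Sum>m\<in>{D<..x + \<kappa>}. real (x + \<kappa> choose m)) \<le> (\<Sum>m\<le>x + \<kappa>. real (x + \<kappa> choose m))"
        by (rule sum_mono2) auto
      also have "\<dots> = 2 ^ (x + \<kappa>)"
        using choose_row_sum[of "x + \<kappa>"] by (metis of_nat_numeral of_nat_power of_nat_sum)
      also have "\<dots> \<le> 2 ^ (2 * e)"
        using that D by (intro power_increasing) auto
      also have "\<dots> \<le> exp (real (2 * e) * 1)"
        using exp_ge_add_one_self[of 1] by (intro power_le_exp) auto
      finally show "(\<Sum>m\<in>{D<..x + \<kappa>}. real (x + \<kappa> choose m)) \<le> exp (2 * real e)" by simp
    qed simp
    also have "\<dots> = exp (2 * real e + - (2 + 5 * real n) * real e) * \<bar>u q\<bar>"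
      unfolding exp_add by (simp only: mult_ac)
    also have "2 * real e + - (2 + 5 * real n) * real e = - 5 * real n * real e"
      by (simp add: algebra_simps)
    also have "exp (- 5 * real n * real e) * \<bar>u q\<bar> \<le> \<eta> * \<bar>u q\<bar>"
    proof (rule mult_right_mono)
      have "- 5 * real n \<le> - 5 * (real (card A) + 1)" using n by simp
      then show "exp (- 5 * real n * real e) \<le> \<eta>"
        unfolding \<eta>_def exp_le_cancel_iff by (rule mult_right_mono) simp
    qed simp
    finally show ?thesis .
  qed

  \<comment> \<open>Otherwise interpolation from \<open>D + 1\<close> bad points makes
    \<open>a \<kappa>\<close> too small for \<open>c'\<close>: it loses less than
    \<open>exp (5 * e)\<close>, whereas \<open>\<eta>\<close> lies below the threshold for
    \<open>c'\<close> by at least that factor.\<close>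
  have "card bad \<le> D"
  proof (rule ccontr)
    assume "\<not> card bad \<le> D"
    then obtain X0 where X0: "X0 \<subseteq> bad" "card X0 = Suc D"
      using obtain_subset_with_card_n[of "Suc D" bad] by (metis not_less_eq_eq)
    then have "X0 \<noteq> {}" by auto
    then obtain x0 where "x0 \<in> bad" using X0(1) by blast
    then have uq: "0 < \<bar>u q\<bar>" by (auto simp: bad_def zero_less_mult_iff)
    let ?X = "(\<lambda>x. x + \<kappa>) ` X0"
    have "\<bar>a \<kappa>\<bar> \<le> 2 ^ \<kappa> * (4 ^ D * exp (real (e + \<kappa>)) * (2 * \<eta> * \<bar>u q\<bar>))"
    proof (rule newton_coeff_le_of_small_values)
      show "card ?X = Suc D" using X0 by (simp add: card_image inj_on_def)
      show "?X \<subseteq> {\<kappa>..e + \<kappa>}" using X0 by (auto simp: bad_def)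
      fix y assume "y \<in> ?X"
      then obtain x where x: "x \<in> bad" "y = x + \<kappa>" using X0 by auto
      show "\<bar>newton_sum D a y\<bar> \<le> 2 * \<eta> * \<bar>u q\<bar>"
        using x approx[of x] unfolding bad_def by (auto simp: abs_le_iff abs_less_iff)
    qed (use D in auto)
    also have "a \<kappa> = (shift_sum A ^^ \<kappa>) u w"
      unfolding a_def w_def using c'0[OF bA] by (intro arg_cong[where f = "(shift_sum A ^^ _) u"]) auto
    finally have "exp (- 5 * real (card A) * real e') * \<bar>u q\<bar> \<le>
        2 ^ \<kappa> * (4 ^ D * exp (real (e + \<kappa>)) * (2 * \<eta> * \<bar>u q\<bar>))"
      using c'good by linarith
    then have "exp (- 5 * real (card A) * real e') \<le> 2 ^ \<kappa> * (4 ^ D * exp (real (e + \<kappa>)) * (2 * \<eta>))"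
      using uq by (simp add: mult.assoc[symmetric])
    also have "\<dots> = 2 ^ (\<kappa> + 2 * D + 1) * exp (real (e + \<kappa>)) * \<eta>"
      by (simp add: power_add power_mult)
    also have "\<dots> \<le> exp (real (\<kappa> + 2 * D + 1) * 1) * exp (real (e + \<kappa>)) * \<eta>"
      using exp_ge_add_one_self[of 1] by (intro mult_right_mono power_le_exp) (auto simp: \<eta>_def)
    also have "\<dots> = exp (real (\<kappa> + 2 * D + 1) + real (e + \<kappa>) + - 5 * (real (card A) + 1) * real e)"
      unfolding \<eta>_def exp_add by simp
    finally have "- 5 * real (card A) * real e' \<le> real (\<kappa> + 2 * D + 1) + real (e + \<kappa>) + - 5 * (real (card A) + 1) * real e"
      by simp
    moreover have "real (card A) * real e' \<le> real (card A) * real e"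
      using e'e by (intro mult_left_mono) auto
    moreover have "real (\<kappa> + 2 * D + 1) + real (e + \<kappa>) < 5 * real e"
      using D \<open>4 * \<kappa> \<le> e\<close> \<open>1 \<le> e\<close> by linarith
    ultimately show False by (simp add: algebra_simps)
  qed
  moreover have "{0..e} - bad \<subseteq> {x \<in> {0..e}. c'(b := x) \<in> good_shifts (insert b A) e u q}"
  proof
    fix x assume x: "x \<in> {0..e} - bad"
    have "sum (c'(b := x)) (insert b A) = x + \<kappa>"
      using fin bA by (simp add: \<kappa>_def) (intro sum.cong, auto)
    moreover have "(\<lambda>i. q i - (c'(b := x)) i) = w(b := q b - x)"
      by (auto simp: w_def)
    moreover have "c'(b := x) \<in> bounded_funs (insert b A) e"
      using x c'0 c'e e'e by (auto simp: bounded_funs_def intro: order_trans)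
    ultimately show "x \<in> {x \<in> {0..e}. c'(b := x) \<in> good_shifts (insert b A) e u q}"
      using x fin bA by (simp add: good_shifts_def bad_def val_def \<eta>_def not_less add.commute)
  qed
  then have "card ({0..e} - bad) \<le> card {x \<in> {0..e}. c'(b := x) \<in> good_shifts (insert b A) e u q}"
    by (intro card_mono) auto
  moreover have "card ({0..e} - bad) = e + 1 - card bad"
    by (subst card_Diff_subset) (auto simp: bad_def)
  ultimately show ?thesis using D by linarith
qed

text \<open>Induction that adjoins a smallest coordinate \<open>b\<close>: by
  \<open>exp_growth_fiber\<close>, each good shift at the reduced scale \<open>e div (4 * n)\<close>
  extends by at least \<open>(e + 1) / 2\<close> values at \<open>b\<close>.\<close>

lemma card_good_shifts_ge:
  assumes "exp_growth n lam J e u q"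
  shows "(real e + 1) ^ card J * (1 / (8 * real n)) ^ (card J * card J) \<le> real (card (good_shifts J e u q))"
proof -
  have "finite J" using assms by (simp add: exp_growth_def)
  then show ?thesis using assms
  proof (induction J arbitrary: e rule: finite_linorder_min_induct)
    case empty
    have "good_shifts {} e u q = {\<lambda>_. 0}"
      by (auto simp: good_shifts_def bounded_funs_def)
    then show ?case by simp
  next
    case (insert b A)
    define m where "m = card A"
    have bA: "b \<notin> A" and n: "1 \<le> n" using insert by (auto simp: exp_growth_def)
    have cJ: "card (insert b A) = Suc m" using insert bA by (simp add: m_def)
    show ?case
    proof (cases "e = 0")
      \<comment> \<open>The fibre bound needs \<open>1 \<le> e\<close>; for \<open>e = 0\<close> the
        zero shift suffices.\<close>
      case True
      have "(\<lambda>_. 0) \<in> good_shifts (insert b A) e u q"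
        using True by (simp add: good_shifts_def bounded_funs_def)
      then have "1 \<le> card (good_shifts (insert b A) e u q)"
        using finite_good_shifts[of "insert b A" e u q] insert(1) by (metis One_nat_def Suc_leI card_gt_0_iff empty_iff finite.insertI)
      then have "1 \<le> real (card (good_shifts (insert b A) e u q))" by simp
      moreover have "(1 / (8 * real n)) ^ (card (insert b A) * card (insert b A)) \<le> 1"
        using n by (intro power_le_one) auto
      ultimately show ?thesis using True by simp
    next
      case False
      then have e: "1 \<le> e" by simp
      define e' where "e' = e div (4 * n)"
      define G where "G = good_shifts A e' u q"
      define X where "X c = {x \<in> {0..e}. c(b := x) \<in> good_shifts (insert b A) e u q}" for c
      have e'e: "e' \<le> e" by (simp add: e'_def)
      have "exp_growth n lam A e' u q"
        unfolding exp_growth_def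
      proof (intro conjI ballI allI impI)
        fix \<alpha> assume \<alpha>: "\<forall>i. i \<notin> A \<longrightarrow> \<alpha> i = q i" "sum \<alpha> A = sum q A" "\<forall>i\<in>A. q i \<le> \<alpha> i + e'"
        then have "q i \<le> \<alpha> i + e" if "i \<in> insert b A" for i
          using that bA e'e by (auto intro: order_trans)
        with \<alpha> have "\<bar>u \<alpha>\<bar> \<le> \<bar>u q\<bar> * exp (\<Sum>i\<in>insert b A. lam i * (real (\<alpha> i) - real (q i)))"
          using insert.prems insert(1) bA unfolding exp_growth_def by auto
        then show "\<bar>u \<alpha>\<bar> \<le> \<bar>u q\<bar> * exp (\<Sum>i\<in>A. lam i * (real (\<alpha> i) - real (q i)))"
          using \<alpha> insert(1) bA by simp
      next
        fix b' assume b': "b' \<in> A"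
        then have "{l \<in> A. b' < l} = {l \<in> insert b A. b' < l}"
          using insert(2) by auto
        then show "8 + 28 * real n + 16 * (\<Sum>l\<in>{l \<in> A. b' < l}. lam l) \<le> lam b'"
          using insert.prems b' by (simp add: exp_growth_def)
      qed (use insert.prems insert(1) cJ e'e in \<open>auto simp: exp_growth_def m_def intro: order_trans\<close>)
      from insert.IH[OF this] have IH: "(real e' + 1) ^ m * (1 / (8 * real n)) ^ (m * m) \<le> real (card G)"
        unfolding G_def m_def .
      have finG: "finite G" unfolding G_def using insert(1) by (rule finite_good_shifts)
      have X: "real e + 1 \<le> 2 * real (card (X c))" if "c \<in> G" for c
        using exp_growth_fiber[OF insert.prems insert(2) e] that unfolding X_def G_def e'_def by simp
      have inj: "inj_on (\<lambda>(c, x). c(b := x)) (SIGMA c:G. X c)"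
      proof (rule inj_onI, clarify)
        fix c x d y assume "c \<in> G" "d \<in> G" and eq: "c(b := x) = d(b := y)"
        then have "c b = 0" "d b = 0" using bA by (auto simp: G_def good_shifts_def bounded_funs_def)
        then show "c = d \<and> x = y" using eq by (metis fun_upd_same fun_upd_triv fun_upd_upd)
      qed
      have "card (SIGMA c:G. X c) = card ((\<lambda>(c, x). c(b := x)) ` (SIGMA c:G. X c))"
        using card_image[OF inj] by simp
      also have "\<dots> \<le> card (good_shifts (insert b A) e u q)"
        using insert(1) by (intro card_mono finite_good_shifts) (auto simp: X_def)
      finally have "(\<Sum>c\<in>G. real (card (X c))) \<le> real (card (good_shifts (insert b A) e u q))"
        using finG by (simp add: card_SigmaI X_def flip: of_nat_sum)
      moreover have "(\<Sum>c\<in>G. (real e + 1) / 2) \<le> (\<Sum>c\<in>G. real (card (X c)))"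
        using X by (intro sum_mono) force
      ultimately have 1: "real (card G) * ((real e + 1) / 2) \<le> real (card (good_shifts (insert b A) e u q))"
        by simp
      have "e < 4 * n * (e' + 1)"
        using dividend_less_times_div[of "4 * n" e] n unfolding e'_def by simp
      then have "real (e + 1) \<le> real (4 * n * (e' + 1))" by (simp only: of_nat_le_iff)
      then have e2: "(real e + 1) / (4 * real n) \<le> real e' + 1"
        using n by (simp add: field_simps)
      \<comment> \<open>The exponent \<open>Suc m * Suc m\<close> exceeds \<open>m * m\<close> by
        \<open>2 * m + 1\<close>: \<open>m\<close> factors pay for passing from \<open>e\<close> to
        \<open>e'\<close>, and \<open>m + 1\<close> for the \<open>1 / 2\<close> of the fibre
        bound.\<close>
      have "(real e + 1) ^ Suc m * (1 / (8 * real n)) ^ (Suc m * Suc m) =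
          (((real e + 1) / (8 * real n)) ^ m * (1 / (8 * real n)) ^ (m * m)) * ((real e + 1) * (1 / (8 * real n)) ^ Suc m)"
        by (simp add: power_add power_divide power_mult_distrib mult_ac)
      also have "\<dots> \<le> ((real e' + 1) ^ m * (1 / (8 * real n)) ^ (m * m)) * ((real e + 1) * (1 / 2))"
      proof (intro mult_mono power_mono)
        show "(real e + 1) / (8 * real n) \<le> real e' + 1"
          by (rule order_trans[OF _ e2]) (use n in \<open>simp add: field_simps\<close>)
        have "(1 / (8 * real n)) ^ Suc m \<le> (1 / (8 * real n)) ^ 1"
          using n by (intro power_decreasing) auto
        also have "\<dots> \<le> 1 / 2" using n by (simp add: field_simps)
        finally show "(1 / (8 * real n)) ^ Suc m \<le> 1 / 2" .
      qed auto
      also have "\<dots> \<le> real (card G) * ((real e + 1) / 2)"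
        using IH by (simp add: mult_right_mono divide_right_mono)
      finally show ?thesis using 1 unfolding cJ by linarith
    qed
  qed
qed

section \<open>Vitali selection and lattice point counts\<close>

text \<open>Keep a member of largest \<open>size\<close>, discard every member that meets it, and
  repeat with the rest.\<close>

lemma greedy_disjoint_subfamily:
  fixes size :: "'a \<Rightarrow> nat" and B :: "'a \<Rightarrow> 'b set"
  assumes "finite T" "\<And>t. t \<in> T \<Longrightarrow> B t \<noteq> {}"
  shows "\<exists>F\<subseteq>T. disjoint_family_on B F \<and> (\<forall>t\<in>T. \<exists>s\<in>F. B s \<inter> B t \<noteq> {} \<and> size t \<le> size s)"
  using assms
proof (induction "card T" arbitrary: T rule: less_induct)
  case less
  show ?case
  proof (cases "T = {}")
    case True
    then show ?thesis by (auto simp: disjoint_family_on_def)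
  next
    case False
    have "Max (size ` T) \<in> size ` T"
      using less.prems(1) False by simp
    then obtain s where s: "s \<in> T" "size s = Max (size ` T)" by force
    have smax: "size t \<le> size s" if "t \<in> T" for t
      using less.prems(1) that s by simp
    define T' where "T' = {t \<in> T. B s \<inter> B t = {}}"
    \<comment> \<open>\<open>B s\<close> is nonempty and so meets itself; thus \<open>s\<close> is
      discarded too.\<close>
    have "T' \<subset> T" using s less.prems(2) by (auto simp: T'_def)
    then have "card T' < card T" using less.prems(1) by (rule psubset_card_mono[rotated])
    then obtain F where F: "F \<subseteq> T'" "disjoint_family_on B F"
      "\<And>t. t \<in> T' \<Longrightarrow> \<exists>s\<in>F. B s \<inter> B t \<noteq> {} \<and> size t \<le> size s"
      using less.hyps[of T'] less.prems by (auto simp: T'_def)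
    have "insert s F \<subseteq> T" using F s by (auto simp: T'_def)
    moreover have "disjoint_family_on B (insert s F)"
      using F(1,2) unfolding disjoint_family_on_def T'_def by blast
    moreover have "\<exists>s\<in>insert s F. B s \<inter> B t \<noteq> {} \<and> size t \<le> size s" if "t \<in> T" for t
      using F(3)[of t] smax that by (cases "t \<in> T'") (auto simp: T'_def)
    ultimately show ?thesis by blast
  qed
qed

text \<open>The ball of radius \<open>w\<close> in the maximum norm, written with additions because
  subtraction truncates.\<close>

definition near :: "nat \<Rightarrow> nat \<Rightarrow> (nat \<Rightarrow> nat) \<Rightarrow> (nat \<Rightarrow> nat) set" where
  "near n w q = {\<alpha>. \<forall>i\<in>{1..n}. \<alpha> i \<le> q i + w \<and> q i \<le> \<alpha> i + w}"

text \<open>Counts the \<open>t\<close> attached to one selected ball: at most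
  \<open>2 * w + 1\<close> choices for a coordinate in \<open>I\<close>, and \<open>R + 1\<close>
  for any other.\<close>

lemma card_near_coordinates_le:
  assumes "I \<subseteq> {1..n}" "card I = k"
  shows "card {t \<in> {1..n} \<rightarrow>\<^sub>E {0..R}. \<forall>i\<in>I. t i \<le> x i + w \<and> x i \<le> t i + w} \<le> (2 * w + 1) ^ k * (R + 1) ^ (n - k)"
proof -
  have fin: "finite I" using assms(1) finite_subset by blast
  define P where "P i = (if i \<in> I then {x i - w..x i + w} else {0..R})" for i
  have "card {t \<in> {1..n} \<rightarrow>\<^sub>E {0..R}. \<forall>i\<in>I. t i \<le> x i + w \<and> x i \<le> t i + w} \<le> card (PiE {1..n} P)"
    by (intro card_mono finite_PiE) (auto simp: P_def PiE_def Pi_def)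
  also have "\<dots> = (\<Prod>i\<in>{1..n}. card (P i))"
    by (rule card_PiE) simp
  also have "\<dots> = (\<Prod>i\<in>I \<union> ({1..n} - I). card (P i))"
    using assms(1) by (intro prod.cong) auto
  also have "\<dots> = (\<Prod>i\<in>I. card (P i)) * (\<Prod>i\<in>{1..n} - I. card (P i))"
    using fin by (intro prod.union_disjoint) auto
  also have "\<dots> \<le> (\<Prod>i\<in>I. 2 * w + 1) * (\<Prod>i\<in>{1..n} - I. R + 1)"
    by (intro mult_le_mono prod_mono) (auto simp: P_def)
  also have "\<dots> = (2 * w + 1) ^ k * (R + 1) ^ (n - k)"
    using assms fin by (simp add: card_Diff_subset)
  finally show ?thesis .
qed

lemma finite_simplex_lattice: "finite (simplex_lattice n N)"
proof (rule finite_subset)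
  show "simplex_lattice n N \<subseteq> bounded_funs {1..n} N"
  proof
    fix \<alpha> assume \<alpha>: "\<alpha> \<in> simplex_lattice n N"
    have "\<alpha> i \<le> N" if "i \<in> {1..n}" for i
      using member_le_sum[of i "{1..n}" \<alpha>] \<alpha> that by (auto simp: simplex_lattice_def)
    then show "\<alpha> \<in> bounded_funs {1..n} N"
      using \<alpha> by (auto simp: simplex_lattice_def bounded_funs_def)
  qed
qed (simp add: finite_bounded_funs)

section \<open>Weighted maximisers and the large values around them\<close>

definition weight :: "nat \<Rightarrow> nat \<Rightarrow> real" where
  "weight n i = (8 + 28 * real n) * 17 ^ (n - i)"

lemma weight_nonneg: "0 \<le> weight n i"
  by (simp add: weight_def)

text \<open>The ratio \<open>17 = 1 + 16\<close> makes the domination required by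
  \<open>exp_growth\<close> an equality for the full index set.\<close>

lemma weight_dominates:
  assumes "b \<le> n"
  shows "8 + 28 * real n + 16 * (\<Sum>l\<in>{b<..n}. weight n l) = weight n b"
  using assms
proof (induction "n - b" arbitrary: b)
  case 0
  then show ?case by (simp add: weight_def)
next
  case (Suc d)
  then have "b < n" by simp
  then have "{b<..n} = insert (Suc b) {Suc b<..n}" by auto
  moreover have "8 + 28 * real n + 16 * (\<Sum>l\<in>{Suc b<..n}. weight n l) = weight n (Suc b)"
    using Suc by (intro Suc.hyps) auto
  moreover have "n - b = Suc (n - Suc b)" using \<open>b < n\<close> by simp
  then have "weight n b = 17 * weight n (Suc b)" by (simp add: weight_def)
  ultimately show ?case by simp
qed

text \<open>Here \<open>\<theta>\<close> is both the error in the hypothesis on \<open>g\<close> and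
  the threshold for a large value; the last assumption keeps transfer errors and values below
  \<open>\<theta>\<close> from adding up to a good shift.\<close>

lemma card_large_near:
  fixes g :: "(nat \<Rightarrow> nat) \<Rightarrow> real"
  assumes n: "1 \<le> n" and q: "q \<in> simplex_lattice n N"
    and max: "\<And>\<alpha>. \<alpha> \<in> simplex_lattice n N \<Longrightarrow> (\<And>i. i \<in> {1..n} \<Longrightarrow> t i \<le> \<alpha> i) \<Longrightarrow>
      \<bar>g \<alpha>\<bar> \<le> \<bar>g q\<bar> * exp (\<Sum>i=1..n. weight n i * (real (\<alpha> i) - real (q i)))"
    and tq: "\<And>i. i \<in> {1..n} \<Longrightarrow> t i \<le> q i"
    and J: "J \<subseteq> {1..n}" "card J = k" "1 \<le> k" and tJ: "\<And>i. i \<in> J \<Longrightarrow> t i + e \<le> q i"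
    and small: "\<And>\<beta>. \<beta> \<in> simplex_lattice n (N - 1) \<Longrightarrow> \<bar>shift_sum {1..n} g \<beta>\<bar> \<le> \<theta>"
    and \<theta>: "0 \<le> \<theta>" "\<And>j. j \<le> k * e \<Longrightarrow> real n ^ j * (real j + 1) * \<theta> < exp (- 5 * real k * real e) * \<bar>g q\<bar>"
  shows "(real e + 1) ^ k * (1 / (8 * real n)) ^ (k * k)
    \<le> real (card ({\<alpha> \<in> simplex_lattice n N. \<theta> \<le> \<bar>g \<alpha>\<bar>} \<inter> near n (k * e) q))"
proof -
  have fin: "finite J" using J(1) finite_subset by blast
  define Z where "Z = {1..n} - J"
  have JZ: "J \<inter> Z = {}" "J \<union> Z = {1..n}" "finite Z" using J by (auto simp: Z_def)
  have q0: "\<And>i. i \<notin> {1..n} \<Longrightarrow> q i = 0" and qN: "sum q J + sum q Z = N"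
    using q sum.union_disjoint[of J Z q] fin JZ by (auto simp: simplex_lattice_def)
  have lattice: "\<alpha> \<in> simplex_lattice n N"
    if "\<And>i. i \<notin> {1..n} \<Longrightarrow> \<alpha> i = 0" "sum \<alpha> J + sum \<alpha> Z = N" for \<alpha>
    using that sum.union_disjoint[of J Z \<alpha>] fin JZ by (auto simp: simplex_lattice_def)
  have "card J \<le> n" using card_mono[OF _ J(1)] by simp
  \<comment> \<open>A point that agrees with \<open>q\<close> off \<open>J\<close> and drops by at
    most \<open>e\<close> on \<open>J\<close> still dominates \<open>t\<close>, so it competes with
    \<open>q\<close>.\<close>
  have "exp_growth n (weight n) J e g q"
    unfolding exp_growth_def
  proof (intro conjI ballI allI impI)
    fix b assume "b \<in> J"
    then have "(\<Sum>l\<in>{l \<in> J. b < l}. weight n l) \<le> (\<Sum>l\<in>{b<..n}. weight n l)"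
      using J by (intro sum_mono2) (auto simp: weight_nonneg)
    then show "8 + 28 * real n + 16 * (\<Sum>l\<in>{l \<in> J. b < l}. weight n l) \<le> weight n b"
      using weight_dominates[of b n] \<open>b \<in> J\<close> J by auto
  next
    fix \<alpha> assume \<alpha>: "\<forall>i. i \<notin> J \<longrightarrow> \<alpha> i = q i" "sum \<alpha> J = sum q J" "\<forall>i\<in>J. q i \<le> \<alpha> i + e"
    have "sum \<alpha> Z = sum q Z" using \<alpha> by (intro sum.cong) (auto simp: Z_def)
    then have "\<alpha> \<in> simplex_lattice n N"
    proof (intro lattice)
      fix i assume i: "i \<notin> {1..n}"
      then have "i \<notin> J" using J(1) by blast
      then show "\<alpha> i = 0" using \<alpha>(1) q0[OF i] by simp
    qed (use \<alpha>(2) qN in simp)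
    moreover have "t i \<le> \<alpha> i" if "i \<in> {1..n}" for i
    proof (cases "i \<in> J")
      case True
      then have "t i + e \<le> \<alpha> i + e" using \<alpha>(3) tJ[of i] order_trans by blast
      then show ?thesis by simp
    qed (use \<alpha> tq that in auto)
    ultimately have "\<bar>g \<alpha>\<bar> \<le> \<bar>g q\<bar> * exp (\<Sum>i=1..n. weight n i * (real (\<alpha> i) - real (q i)))"
      by (rule max)
    also have "(\<Sum>i=1..n. weight n i * (real (\<alpha> i) - real (q i))) = (\<Sum>i\<in>J. weight n i * (real (\<alpha> i) - real (q i)))"
      using J \<alpha> by (intro sum.mono_neutral_right) auto
    finally show "\<bar>g \<alpha>\<bar> \<le> \<bar>g q\<bar> * exp (\<Sum>i\<in>J. weight n i * (real (\<alpha> i) - real (q i)))" .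
  qed (use fin n \<open>card J \<le> n\<close> tJ in \<open>auto simp: weight_nonneg intro: add_leD2\<close>)
  from card_good_shifts_ge[OF this]
  have many: "(real e + 1) ^ k * (1 / (8 * real n)) ^ (k * k) \<le> real (card (good_shifts J e g q))"
    using J by simp
  have "\<exists>\<alpha>. \<alpha> \<in> simplex_lattice n N \<and> \<theta> \<le> \<bar>g \<alpha>\<bar> \<and> \<alpha> \<in> near n (k * e) q \<and> (\<forall>i\<in>J. \<alpha> i = q i - c i)"
    if "c \<in> good_shifts J e g q" for c
  proof -
    define j where "j = sum c J"
    define \<gamma> where "\<gamma> = (\<lambda>i. q i - c i)"
    have c0: "\<And>i. i \<notin> J \<Longrightarrow> c i = 0" and ce: "\<And>i. i \<in> J \<Longrightarrow> c i \<le> e"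
      and big: "exp (- 5 * real k * real e) * \<bar>g q\<bar> \<le> \<bar>(shift_sum J ^^ j) g \<gamma>\<bar>"
      using that J by (auto simp: good_shifts_def bounded_funs_def j_def \<gamma>_def)
    have eq: "e \<le> q i" if "i \<in> J" for i using tJ[OF that] by simp
    have jk: "j \<le> k * e"
      unfolding j_def using sum_bounded_above[of J c e] ce J by simp
    have \<gamma>Z: "sum \<gamma> Z = sum q Z"
      by (intro sum.cong) (auto simp: \<gamma>_def c0 Z_def)
    have "j \<le> sum q J"
      unfolding j_def using ce eq by (intro sum_mono) (meson order_trans)
    moreover have "sum \<gamma> J = sum q J - j"
      unfolding \<gamma>_def j_def using ce eq by (intro sum_subtractf_nat) (meson order_trans)
    ultimately have \<gamma>N: "sum \<gamma> J + sum \<gamma> Z + j = N" using \<gamma>Z qN by simp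
    \<comment> \<open>All \<open>j\<close> shifts leave the directions of \<open>J\<close>, so the
      \<open>J\<close>-coordinates of \<open>\<gamma>\<close> survive.\<close>
    have "\<bar>(shift_sum J ^^ j) g \<gamma>\<bar> \<le> \<bar>(shift_sum J ^^ 0) ((shift_sum Z ^^ j) g) \<gamma>\<bar> + real j * real n ^ j * \<theta>"
    proof (rule shift_sum_pow_transfer[OF fin JZ(3,1)])
      show "card (J \<union> Z) \<le> n" unfolding JZ by simp
      fix \<beta> assume \<beta>: "\<And>i. i \<notin> J \<union> Z \<Longrightarrow> \<beta> i = \<gamma> i" "Suc (sum \<beta> (J \<union> Z)) = sum \<gamma> (J \<union> Z) + j"
      have "sum \<gamma> (J \<union> Z) + j = N"
        using \<gamma>N fin JZ(1,3) by (simp add: sum.union_disjoint)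
      then have "\<beta> \<in> simplex_lattice n (N - 1)"
        using \<beta> q0 unfolding JZ by (auto simp: simplex_lattice_def \<gamma>_def)
      then show "\<bar>shift_sum (J \<union> Z) g \<beta>\<bar> \<le> \<theta>" unfolding JZ by (rule small)
    qed (use n \<theta> in auto)
    with big have 1: "exp (- 5 * real k * real e) * \<bar>g q\<bar> \<le> \<bar>(shift_sum Z ^^ j) g \<gamma>\<bar> + real j * real n ^ j * \<theta>"
      by simp
    \<comment> \<open>Otherwise the main term is at most \<open>n ^ j * \<theta>\<close>, and
      together with the error \<open>j * n ^ j * \<theta>\<close> this contradicts the bound on
      \<open>\<theta>\<close>.\<close>
    have "\<exists>\<delta>\<in>compositions Z j. \<theta> \<le> \<bar>g (\<gamma> + \<delta>)\<bar>"
    proof (rule ccontr)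
      assume "\<not> ?thesis"
      then have "\<bar>(shift_sum Z ^^ j) g \<gamma>\<bar> \<le> real (card Z) ^ j * \<theta>"
        by (intro shift_sum_pow_bound JZ) (auto simp: not_le less_imp_le)
      also have "card Z \<le> n" using card_mono[of "{1..n}" Z] by (auto simp: Z_def)
      then have "real (card Z) ^ j * \<theta> \<le> real n ^ j * \<theta>"
        using \<theta> by (intro mult_right_mono power_mono) auto
      finally show False using 1 \<theta>(2)[OF jk] by (simp add: algebra_simps)
    qed
    then obtain \<delta> where \<delta>: "\<delta> \<in> compositions Z j" "\<theta> \<le> \<bar>g (\<gamma> + \<delta>)\<bar>" by blast
    have \<delta>0: "\<And>i. i \<notin> Z \<Longrightarrow> \<delta> i = 0" and \<delta>j: "sum \<delta> Z = j"
      using \<delta> by (auto simp: compositions_def)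
    define \<alpha> where "\<alpha> = (\<lambda>i. \<gamma> i + \<delta> i)"
    have \<alpha>J: "\<alpha> i = q i - c i" if "i \<in> J" for i
      using that \<delta>0[of i] by (auto simp: \<alpha>_def \<gamma>_def Z_def)
    have \<alpha>Z: "\<alpha> i = q i + \<delta> i" if "i \<in> Z" for i
      using that c0[of i] by (auto simp: \<alpha>_def \<gamma>_def Z_def)
    have "\<alpha> \<in> simplex_lattice n N"
    proof (rule lattice)
      have "sum \<alpha> J = sum \<gamma> J" by (intro sum.cong) (auto simp: \<alpha>J \<gamma>_def)
      moreover have "sum \<alpha> Z = sum \<gamma> Z + j" by (simp add: \<alpha>_def sum.distrib \<delta>j)
      ultimately show "sum \<alpha> J + sum \<alpha> Z = N" using \<gamma>N by simp
      show "\<alpha> i = 0" if "i \<notin> {1..n}" for i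
        using that q0[of i] \<delta>0[of i] by (auto simp: \<alpha>_def \<gamma>_def Z_def)
    qed
    moreover have "\<alpha> \<in> near n (k * e) q"
      unfolding near_def
    proof (intro CollectI ballI)
      fix i assume "i \<in> {1..n}"
      then consider "i \<in> J" | "i \<in> Z" by (auto simp: Z_def)
      then show "\<alpha> i \<le> q i + k * e \<and> q i \<le> \<alpha> i + k * e"
      proof cases
        case 1
        have "e \<le> k * e" using J(3) by simp
        then have "c i \<le> k * e" using ce[OF 1] by (rule order_trans[rotated])
        then show ?thesis unfolding \<alpha>J[OF 1] by linarith
      next
        case 2
        then have "\<delta> i \<le> j" using member_le_sum[of i Z \<delta>] JZ(3) \<delta>j by simp
        then show ?thesis using \<alpha>Z[OF 2] jk by simp
      qed
    qed
    moreover have "\<gamma> + \<delta> = \<alpha>" by (simp add: \<alpha>_def plus_fun_def)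
    ultimately show ?thesis using \<delta>(2) \<alpha>J by auto
  qed
  then obtain f where f: "\<And>c. c \<in> good_shifts J e g q \<Longrightarrow>
      f c \<in> {\<alpha> \<in> simplex_lattice n N. \<theta> \<le> \<bar>g \<alpha>\<bar>} \<inter> near n (k * e) q \<and> (\<forall>i\<in>J. f c i = q i - c i)"
    by (metis (mono_tags, lifting) IntI mem_Collect_eq)
  \<comment> \<open>The \<open>J\<close>-coordinates of \<open>f c\<close> determine
    \<open>c\<close>, since \<open>c i \<le> e \<le> q i\<close> makes the subtraction
    exact.\<close>
  have "inj_on f (good_shifts J e g q)"
  proof (rule inj_onI, rule ext)
    fix c d i assume c: "c \<in> good_shifts J e g q" and d: "d \<in> good_shifts J e g q" and eq: "f c = f d"
    show "c i = d i"
    proof (cases "i \<in> J")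
      case True
      then have "q i - c i = q i - d i" using f[OF c] f[OF d] eq by metis
      moreover have "c i \<le> e" "d i \<le> e" "e \<le> q i"
        using c d True tJ[OF True] by (auto simp: good_shifts_def bounded_funs_def)
      ultimately show ?thesis by linarith
    next
      case False
      then show ?thesis using c d by (auto simp: good_shifts_def bounded_funs_def)
    qed
  qed
  then have "card (good_shifts J e g q) \<le> card ({\<alpha> \<in> simplex_lattice n N. \<theta> \<le> \<bar>g \<alpha>\<bar>} \<inter> near n (k * e) q)"
    by (rule card_inj_on_le) (use f finite_simplex_lattice[of n N] in auto)
  then show ?thesis using many by linarith
qed

text \<open>One \<open>e\<close> serves both conclusions: at least \<open>k\<close> gaps are
  \<open>\<ge> e\<close>, which provides \<open>J\<close>, and since
  \<open>2 * k \<le> n + 1\<close> at least \<open>k\<close> gaps are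
  \<open>\<le> e\<close>.\<close>

lemma exists_center:
  fixes g :: "(nat \<Rightarrow> nat) \<Rightarrow> real"
  assumes n: "1 \<le> k" "2 * k \<le> n + 1" "1 \<le> R" and t: "\<And>i. i \<in> {1..n} \<Longrightarrow> t i \<le> R"
    and g0: "g (diag_vec n R) \<noteq> 0"
    and \<theta>: "\<theta> = exp (- C * real R) * \<bar>g (diag_vec n R)\<bar>"
    and C: "C = real n ^ 3 + 6 * real n ^ 2 + 1 + (\<Sum>i=1..n. weight n i)"
    and small: "\<And>\<beta>. \<beta> \<in> simplex_lattice n (n * R - 1) \<Longrightarrow> \<bar>shift_sum {1..n} g \<beta>\<bar> \<le> \<theta>"
  shows "\<exists>q e. (real e + 1) ^ k * (1 / (8 * real n)) ^ (k * k)
      \<le> real (card ({\<alpha> \<in> simplex_lattice n (n * R). \<theta> \<le> \<bar>g \<alpha>\<bar>} \<inter> near n (k * e) q)) \<and>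
    k \<le> card {i \<in> {1..n}. t i \<le> q i + e \<and> q i \<le> t i + e}"
proof -
  define N where "N = n * R"
  define \<Lambda> where "\<Lambda> = (\<Sum>i=1..n. weight n i)"
  define S where "S = {\<alpha> \<in> simplex_lattice n N. \<forall>i\<in>{1..n}. t i \<le> \<alpha> i}"
  define f where "f \<alpha> = \<bar>g \<alpha>\<bar> * exp (- (\<Sum>i=1..n. weight n i * real (\<alpha> i)))" for \<alpha>
  have kn: "k \<le> n" "1 \<le> n" using n by linarith+
  have diag: "diag_vec n R \<in> S"
    using t by (auto simp: S_def simplex_lattice_def diag_vec_def N_def)
  have "finite S" unfolding S_def using finite_simplex_lattice[of n N] by simp
  then have "Max (f ` S) \<in> f ` S" using diag by (intro Max_in) auto
  then obtain q where q: "q \<in> S" and fq: "f q = Max (f ` S)" by force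
  have fmax: "f \<alpha> \<le> f q" if "\<alpha> \<in> S" for \<alpha>
    unfolding fq using that \<open>finite S\<close> by simp
  have qL: "q \<in> simplex_lattice n N" and tq: "\<And>i. i \<in> {1..n} \<Longrightarrow> t i \<le> q i"
    using q by (auto simp: S_def)
  have max: "\<bar>g \<alpha>\<bar> \<le> \<bar>g q\<bar> * exp (\<Sum>i=1..n. weight n i * (real (\<alpha> i) - real (q i)))"
    if "\<alpha> \<in> simplex_lattice n N" "\<And>i. i \<in> {1..n} \<Longrightarrow> t i \<le> \<alpha> i" for \<alpha>
  proof -
    have "f \<alpha> \<le> f q" using that by (intro fmax) (auto simp: S_def)
    then have "f \<alpha> * exp (\<Sum>i=1..n. weight n i * real (\<alpha> i)) \<le> f q * exp (\<Sum>i=1..n. weight n i * real (\<alpha> i))"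
      by (rule mult_right_mono) simp
    then show ?thesis
      by (simp add: f_def mult.assoc exp_add[symmetric] right_diff_distrib sum_subtractf)
  qed
  \<comment> \<open>The diagonal point competes with \<open>q\<close> because
    \<open>t \<le> R\<close>; its weights total \<open>\<Lambda> * R\<close>, and those at
    \<open>q\<close> only lower \<open>f q\<close>.\<close>
  have gq: "exp (- \<Lambda> * real R) * \<bar>g (diag_vec n R)\<bar> \<le> \<bar>g q\<bar>"
  proof -
    have "exp (- \<Lambda> * real R) * \<bar>g (diag_vec n R)\<bar> = f (diag_vec n R)"
      by (simp add: f_def \<Lambda>_def diag_vec_def sum_distrib_left mult.commute)
    also have "\<dots> \<le> f q" by (rule fmax[OF diag])
    also have "\<dots> \<le> \<bar>g q\<bar> * 1"
      unfolding f_def by (intro mult_left_mono) (auto simp: weight_nonneg intro!: sum_nonneg)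
    finally show ?thesis by simp
  qed
  define H where "H e = card {i \<in> {1..n}. t i + e \<le> q i}" for e
  have "{i \<in> {1..n}. t i + 0 \<le> q i} = {1..n}" using tq by auto
  then have H0: "k \<le> H 0" using kn by (simp add: H_def)
  have HN: "e \<le> N" if "k \<le> H e" for e
  proof -
    have "card {i \<in> {1..n}. t i + e \<le> q i} \<noteq> 0" using that n(1) unfolding H_def by linarith
    then have "{i \<in> {1..n}. t i + e \<le> q i} \<noteq> {}" by (metis card.empty)
    then obtain i where i: "i \<in> {1..n}" "t i + e \<le> q i" by auto
    have "q i \<le> N" using member_le_sum[of i "{1..n}" q] i(1) qL by (auto simp: simplex_lattice_def)
    then show ?thesis using i by simp
  qed
  \<comment> \<open>This is the \<open>k\<close>-th largest gap \<open>q i - t i\<close>.\<close>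
  define e where "e = (GREATEST e. k \<le> H e)"
  have He: "k \<le> H e"
    unfolding e_def by (rule GreatestI_nat[where P = "\<lambda>e. k \<le> H e", OF H0 HN])
  have "\<not> k \<le> H (Suc e)"
    using Greatest_le_nat[where P = "\<lambda>e. k \<le> H e" and k = "Suc e" and b = N] HN unfolding e_def by force
  then have "H (Suc e) < k" by simp
  have eq: "{i \<in> {1..n}. t i \<le> q i + e \<and> q i \<le> t i + e} = {1..n} - {i \<in> {1..n}. t i + Suc e \<le> q i}"
    using tq by (auto intro: trans_le_add1)
  have "card {i \<in> {1..n}. t i \<le> q i + e \<and> q i \<le> t i + e} = card {1..n} - H (Suc e)"
    unfolding H_def eq by (rule card_Diff_subset) auto
  then have near: "k \<le> card {i \<in> {1..n}. t i \<le> q i + e \<and> q i \<le> t i + e}"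
    using \<open>H (Suc e) < k\<close> n(2) by simp
  obtain J where J: "J \<subseteq> {i \<in> {1..n}. t i + e \<le> q i}" "card J = k"
    using obtain_subset_with_card_n[OF He[unfolded H_def]] by blast
  have "(real e + 1) ^ k * (1 / (8 * real n)) ^ (k * k)
    \<le> real (card ({\<alpha> \<in> simplex_lattice n N. \<theta> \<le> \<bar>g \<alpha>\<bar>} \<inter> near n (k * e) q))"
  proof (rule card_large_near[OF kn(2) qL max tq _ J(2) n(1)])
    show "J \<subseteq> {1..n}" "\<And>i. i \<in> J \<Longrightarrow> t i + e \<le> q i" using J by auto
    show "0 \<le> \<theta>" by (simp add: \<theta>)
    fix j assume j: "j \<le> k * e"
    have "k * e \<le> n * (n * R)"
      using kn HN[OF He] by (intro mult_le_mono) (auto simp: N_def)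
    then have ke: "real k * real e \<le> real n ^ 2 * real R"
      unfolding power2_eq_square by (simp flip: of_nat_mult add: mult.assoc)
    have jR: "real j \<le> real n ^ 2 * real R"
      using ke j by (metis of_nat_le_iff of_nat_mult order_trans)
    have "real n ^ j \<le> exp (real j * real n)"
      using exp_ge_add_one_self[of "real n"] by (intro power_le_exp, simp, linarith)
    also have "\<dots> \<le> exp (real n ^ 3 * real R)"
      using mult_right_mono[OF jR, of "real n"] by (simp add: power3_eq_cube power2_eq_square mult_ac)
    finally have "real n ^ j * (real j + 1) \<le> exp (real n ^ 3 * real R) * exp (real n ^ 2 * real R)"
    proof (rule mult_mono)
      show "real j + 1 \<le> exp (real n ^ 2 * real R)"
        using exp_ge_add_one_self[of "real j"] jR exp_le_cancel_iff[of "real j" "real n ^ 2 * real R"] by linarith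
    qed auto
    then have "real n ^ j * (real j + 1) * \<theta> \<le> exp (real n ^ 3 * real R) * exp (real n ^ 2 * real R) * \<theta>"
      by (rule mult_right_mono) (simp add: \<theta>)
    also have "\<dots> = exp (real n ^ 3 * real R + real n ^ 2 * real R + - C * real R) * \<bar>g (diag_vec n R)\<bar>"
      unfolding \<theta> exp_add by simp
    \<comment> \<open>The terms of \<open>C\<close>: \<open>n ^ 3\<close> pays for
      \<open>n ^ j\<close>, one \<open>n ^ 2\<close> for \<open>j + 1\<close>, the other five for
      \<open>exp (- 5 * k * e)\<close>, and \<open>\<Lambda>\<close> for passing from the diagonal
      to \<open>q\<close>; the summand 1 gives strictness.\<close>
    also have "\<dots> < exp (- 5 * (real n ^ 2 * real R) + - \<Lambda> * real R) * \<bar>g (diag_vec n R)\<bar>"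
      using g0 n(3) by (intro mult_strict_right_mono) (auto simp: C \<Lambda>_def algebra_simps)
    also have "\<dots> = exp (- 5 * (real n ^ 2 * real R)) * (exp (- \<Lambda> * real R) * \<bar>g (diag_vec n R)\<bar>)"
      unfolding exp_add by simp
    also have "\<dots> \<le> exp (- 5 * real k * real e) * \<bar>g q\<bar>"
      using ke gq by (intro mult_mono) auto
    finally show "real n ^ j * (real j + 1) * \<theta> < exp (- 5 * real k * real e) * \<bar>g q\<bar>" .
  qed (use small in \<open>auto simp: N_def\<close>)
  then show ?thesis using near unfolding N_def by blast
qed

section \<open>Covering the box of all \<open>t\<close> from the selected balls\<close>

theorem theorem2p1:
  fixes n :: nat
  assumes "n \<ge> 3"
  shows "\<exists>c C :: real. c > 0 \<and> C > 0 \<and>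
    (\<forall>R::nat. R \<ge> 1 \<longrightarrow>
      (\<forall>g :: (nat \<Rightarrow> nat) \<Rightarrow> real.
        g (diag_vec n R) \<noteq> 0 \<longrightarrow>
        (\<forall>\<beta> \<in> simplex_lattice n (n * R - 1).
          \<bar>\<Sum>i=1..n. g (\<beta> + unit_vec i)\<bar> \<le> exp (- C * real R) * \<bar>g (diag_vec n R)\<bar>) \<longrightarrow>
        real (card {\<alpha> \<in> simplex_lattice n (n * R).
          \<bar>g \<alpha>\<bar> \<ge> exp (- C * real R) * \<bar>g (diag_vec n R)\<bar>})
          \<ge> c * real R ^ nat \<lceil>real n / 2\<rceil>))"
proof -
  define k where "k = nat \<lceil>real n / 2\<rceil>"
  have k: "1 \<le> k" "2 * k \<le> n + 1"
    unfolding k_def using assms by linarith+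
  then have kn: "k \<le> n" by linarith
  define C where "C = real n ^ 3 + 6 * real n ^ 2 + 1 + (\<Sum>i=1..n. weight n i)"
  define c1 where "c1 = (1 / (8 * real n)) ^ (k * k)"
  \<comment> \<open>\<open>2 ^ n\<close> bounds the number of index sets \<open>I\<close>, and
    \<open>2 * (2 * k + 1) * (E s + 1)\<close> will bound \<open>2 * w s + 1\<close>.\<close>
  define c2 where "c2 = 2 ^ n * (2 * (2 * real k + 1)) ^ k"
  have c: "0 < c1" "0 < c2" using assms by (auto simp: c1_def c2_def)
  have "0 < C" unfolding C_def using assms by (intro add_pos_nonneg) (auto intro!: sum_nonneg weight_nonneg add_nonneg_pos)
  have "c1 / c2 * real R ^ k \<le> real (card {\<alpha> \<in> simplex_lattice n (n * R). \<theta> \<le> \<bar>g \<alpha>\<bar>})"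
    if R: "1 \<le> R" and g0: "g (diag_vec n R) \<noteq> 0" and \<theta>: "\<theta> = exp (- C * real R) * \<bar>g (diag_vec n R)\<bar>"
      and small: "\<forall>\<beta> \<in> simplex_lattice n (n * R - 1). \<bar>\<Sum>i=1..n. g (\<beta> + unit_vec i)\<bar> \<le> \<theta>"
    for R \<theta> and g :: "(nat \<Rightarrow> nat) \<Rightarrow> real"
  proof -
    define S where "S = {\<alpha> \<in> simplex_lattice n (n * R). \<theta> \<le> \<bar>g \<alpha>\<bar>}"
    define T where "T = {1..n} \<rightarrow>\<^sub>E {0..R}"
    have finT: "finite T" unfolding T_def by (intro finite_PiE) auto
    have finS: "finite S" unfolding S_def using finite_simplex_lattice[of n "n * R"] by simp
    have "\<forall>t\<in>T. \<exists>q e. (real e + 1) ^ k * c1 \<le> real (card (S \<inter> near n (k * e) q)) \<and>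
      k \<le> card {i \<in> {1..n}. t i \<le> q i + e \<and> q i \<le> t i + e}"
    proof
      fix t assume "t \<in> T"
      then have "t i \<le> R" if "i \<in> {1..n}" for i using that by (auto simp: T_def PiE_def Pi_def)
      then show "\<exists>q e. (real e + 1) ^ k * c1 \<le> real (card (S \<inter> near n (k * e) q)) \<and>
        k \<le> card {i \<in> {1..n}. t i \<le> q i + e \<and> q i \<le> t i + e}"
        unfolding c1_def S_def
      proof (rule exists_center[where C = C, OF k R])
        fix \<beta> assume "\<beta> \<in> simplex_lattice n (n * R - 1)"
        then show "\<bar>shift_sum {1..n} g \<beta>\<bar> \<le> \<theta>"
          using small by (simp add: shift_sum_def)
      qed (assumption | rule g0 \<theta> C_def)+
    qed
    from bchoice[OF this] obtain Q where "\<forall>t\<in>T. \<exists>e. (real e + 1) ^ k * c1 \<le> real (card (S \<inter> near n (k * e) (Q t))) \<and>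
      k \<le> card {i \<in> {1..n}. t i \<le> Q t i + e \<and> Q t i \<le> t i + e}"
      by blast
    from bchoice[OF this] obtain E where
        QE: "\<And>t. t \<in> T \<Longrightarrow> (real (E t) + 1) ^ k * c1 \<le> real (card (S \<inter> near n (k * E t) (Q t)))"
        "\<And>t. t \<in> T \<Longrightarrow> k \<le> card {i \<in> {1..n}. t i \<le> Q t i + E t \<and> Q t i \<le> t i + E t}"
      by blast
    define B where "B t = near n (k * E t) (Q t)" for t
    have "Q t \<in> B t" for t by (simp add: B_def near_def)
    then have "\<exists>F\<subseteq>T. disjoint_family_on B F \<and> (\<forall>t\<in>T. \<exists>s\<in>F. B s \<inter> B t \<noteq> {} \<and> E t \<le> E s)"
      by (intro greedy_disjoint_subfamily finT) auto
    then obtain F where F: "F \<subseteq> T" "disjoint_family_on B F"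
        "\<And>t. t \<in> T \<Longrightarrow> \<exists>s\<in>F. B s \<inter> B t \<noteq> {} \<and> E t \<le> E s"
      by blast
    have finF: "finite F" using F(1) finT by (rule finite_subset)
    \<comment> \<open>The triangle inequality through a common point of two balls:
      \<open>k * E s\<close> from \<open>Q s\<close> to it, \<open>k * E t\<close> on to
      \<open>Q t\<close>, and \<open>E t\<close> on to \<open>t\<close>, where
      \<open>E t \<le> E s\<close>.\<close>
    define w where "w s = (2 * k + 1) * E s" for s
    define \<I> where "\<I> = {I. I \<subseteq> {1..n} \<and> card I = k}"
    define K where "K s I = {t \<in> T. \<forall>i\<in>I. t i \<le> Q s i + w s \<and> Q s i \<le> t i + w s}" for s I
    have fin\<I>: "finite \<I>" unfolding \<I>_def by (rule finite_subset[of _ "Pow {1..n}"]) auto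
    have "card \<I> \<le> card (Pow {1..n})" unfolding \<I>_def by (intro card_mono) auto
    then have card\<I>: "card \<I> \<le> 2 ^ n" by (simp add: card_Pow)
    have "T \<subseteq> (\<Union>s\<in>F. \<Union>I\<in>\<I>. K s I)"
    proof
      fix t assume t: "t \<in> T"
      obtain s \<alpha> where s: "s \<in> F" "\<alpha> \<in> B s" "\<alpha> \<in> B t" "E t \<le> E s" using F(3)[OF t] by blast
      obtain I where I: "I \<subseteq> {i \<in> {1..n}. t i \<le> Q t i + E t \<and> Q t i \<le> t i + E t}" "card I = k"
        using obtain_subset_with_card_n[OF QE(2)[OF t]] by blast
      have "k * E t \<le> k * E s" using s(4) by simp
      have "t i \<le> Q s i + w s \<and> Q s i \<le> t i + w s" if "i \<in> I" for i
      proof -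
        have "i \<in> {1..n}" "t i \<le> Q t i + E t" "Q t i \<le> t i + E t" using that I(1) by auto
        moreover from this have "\<alpha> i \<le> Q s i + k * E s" "Q s i \<le> \<alpha> i + k * E s"
            "\<alpha> i \<le> Q t i + k * E t" "Q t i \<le> \<alpha> i + k * E t"
          using s(2,3) unfolding B_def near_def by auto
        moreover have "w s = k * E s + k * E s + E s" by (simp add: w_def algebra_simps)
        ultimately show ?thesis using s(4) \<open>k * E t \<le> k * E s\<close> by linarith
      qed
      then have "t \<in> K s I" using t unfolding K_def by blast
      moreover have "I \<in> \<I>" using I unfolding \<I>_def by blast
      ultimately show "t \<in> (\<Union>s\<in>F. \<Union>I\<in>\<I>. K s I)" using s(1) by blast
    qed
    then have "card T \<le> card (\<Union>s\<in>F. \<Union>I\<in>\<I>. K s I)"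
      using finF fin\<I> finT by (intro card_mono) (auto simp: K_def)
    also have "\<dots> \<le> (\<Sum>s\<in>F. card (\<Union>I\<in>\<I>. K s I))"
      using finF by (rule card_UN_le)
    also have "\<dots> \<le> (\<Sum>s\<in>F. \<Sum>I\<in>\<I>. card (K s I))"
      using fin\<I> by (intro sum_mono card_UN_le)
    also have "\<dots> \<le> (\<Sum>s\<in>F. \<Sum>I\<in>\<I>. (2 * w s + 1) ^ k * (R + 1) ^ (n - k))"
      unfolding K_def T_def by (intro sum_mono card_near_coordinates_le) (auto simp: \<I>_def)
    also have "\<dots> = (\<Sum>s\<in>F. card \<I> * ((2 * w s + 1) ^ k * (R + 1) ^ (n - k)))" by simp
    also have "\<dots> \<le> (\<Sum>s\<in>F. 2 ^ n * ((2 * (2 * k + 1) * (E s + 1)) ^ k * (R + 1) ^ (n - k)))"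
      using card\<I> by (intro sum_mono mult_le_mono power_mono) (auto simp: w_def algebra_simps)
    \<comment> \<open>The factor \<open>(R + 1) ^ (n - k)\<close> occurs on both sides and is
      cancelled below.\<close>
    also have "card T = (R + 1) ^ k * (R + 1) ^ (n - k)"
      using kn by (simp add: T_def card_PiE power_add[symmetric])
    finally have "real ((R + 1) ^ k * (R + 1) ^ (n - k)) \<le>
      real (\<Sum>s\<in>F. 2 ^ n * ((2 * (2 * k + 1) * (E s + 1)) ^ k * (R + 1) ^ (n - k)))"
      by (simp only: of_nat_le_iff)
    also have "\<dots> = c2 * (\<Sum>s\<in>F. (real (E s) + 1) ^ k) * real ((R + 1) ^ (n - k))"
      unfolding of_nat_sum sum_distrib_left sum_distrib_right
    proof (intro sum.cong refl)
      fix s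
      have "real (2 * (2 * k + 1) * (E s + 1)) = 2 * (2 * real k + 1) * (real (E s) + 1)"
        by (simp add: algebra_simps)
      then have "real (2 * (2 * k + 1) * (E s + 1)) ^ k = (2 * (2 * real k + 1)) ^ k * (real (E s) + 1) ^ k"
        by (simp only: power_mult_distrib)
      then show "real (2 ^ n * ((2 * (2 * k + 1) * (E s + 1)) ^ k * (R + 1) ^ (n - k))) =
          c2 * (real (E s) + 1) ^ k * real ((R + 1) ^ (n - k))"
        by (simp only: c2_def of_nat_mult[of "2 ^ n"] of_nat_mult[of "_ ^ k"] of_nat_power[of _ k]
            of_nat_power[of 2] of_nat_numeral mult.assoc)
    qed
    finally have "real (R + 1) ^ k * real ((R + 1) ^ (n - k)) \<le>
        c2 * (\<Sum>s\<in>F. (real (E s) + 1) ^ k) * real ((R + 1) ^ (n - k))"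
      by simp
    then have "real (R + 1) ^ k \<le> c2 * (\<Sum>s\<in>F. (real (E s) + 1) ^ k)"
      by (rule mult_right_le_imp_le) simp
    moreover have "real R ^ k \<le> real (R + 1) ^ k" by (intro power_mono) auto
    ultimately have "real R ^ k / c2 \<le> (\<Sum>s\<in>F. (real (E s) + 1) ^ k)"
      using c by (simp add: divide_le_eq mult.commute)
    then have "c1 * (real R ^ k / c2) \<le> c1 * (\<Sum>s\<in>F. (real (E s) + 1) ^ k)"
      by (rule mult_left_mono) (use c in simp)
    then have "c1 / c2 * real R ^ k \<le> (\<Sum>s\<in>F. (real (E s) + 1) ^ k) * c1"
      by (simp add: mult.commute)
    also have "\<dots> \<le> (\<Sum>s\<in>F. real (card (S \<inter> B s)))"
      unfolding sum_distrib_right B_def using F(1) by (intro sum_mono QE) auto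
    \<comment> \<open>The selected balls are disjoint, so no large point is counted twice.\<close>
    also have "\<dots> = real (card (\<Union>s\<in>F. S \<inter> B s))"
      using finF finS F(2) by (subst card_UN_disjoint) (auto simp: disjoint_family_on_def)
    also have "\<dots> \<le> real (card S)"
      using finS by (intro of_nat_mono card_mono) auto
    finally show ?thesis unfolding S_def .
  qed
  then show ?thesis
    using c \<open>0 < C\<close> unfolding k_def[symmetric] by (intro exI[of _ "c1 / c2"] exI[of _ C]) auto
qed

end
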